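(* Let $A,C$ be nonempty compact convex sets in $\mathbb{R}^2$. Then $$|A-C|\le|A+C|+2\sqrt{|A|\,|C|}.$$ Moreover, equality holds only in the following cases: (i) one of $A$, $C$ is a single point or a segment (and the other is an arbitrary convex set); or (ii) $A$ is a triangle and $C=tA+b$ for some $t>0$ and $b\in\mathbb{R}^2$.
   Context: $|\cdot|$ is area (2-dimensional Lebesgue measure); $A+C$ and $A-C=\{a-c:a\in A,c\in C\}$ are Minkowski sum and difference; $tA+b=\{ta+b:a\in A\}$. *)

theory Defs
  imports "HOL-Analysis.Analysis"
begin

definition minkowski_sum :: "'a::ab_group_add set \<Rightarrow> 'a set \<Rightarrow> 'a set" where
  "minkowski_sum A C = {a + c | a c. a \<in> A \<and> c \<in> C}"

definition minkowski_diff :: "'a::ab_group_add set \<Rightarrow> 'a set \<Rightarrow> 'a set" where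
  "minkowski_diff A C = {a - c | a c. a \<in> A \<and> c \<in> C}"

definition point_or_segment :: "(real^2) set \<Rightarrow> bool" where
  "point_or_segment S \<longleftrightarrow> (\<exists>p. S = {p}) \<or> (\<exists>p q. S = closed_segment p q)"

definition is_triangle :: "(real^2) set \<Rightarrow> bool" where
  "is_triangle S \<longleftrightarrow> (\<exists>x y z. \<not> collinear {x, y, z} \<and> S = convex hull {x, y, z})"

end

theory Submission
  imports Defs
begin

text \<open>
  Write \<open>V\<close> for the mixed area and \<open>F A C = V A (- C) - V A C\<close>; the claim is
  \<open>F A C \<le> sqrt (|A| |C|)\<close>. Since \<open>F\<close> is bilinear and odd under reflection of an argument,
  \<open>F (s A - t C) (s A - t C) = s\<^sup>2 F A A - 2 s t F A C + t\<^sup>2 F C C\<close>, which is nonnegative by Minkowski's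
  inequality \<open>V K (- K) \<ge> |K|\<close>. The planar Rogers-Shephard inequality \<open>V A (- A) \<le> 2 |A|\<close> gives
  \<open>F A A \<le> |A|\<close> and \<open>F C C \<le> |C|\<close>, and \<open>s = sqrt |C|\<close>, \<open>t = sqrt |A|\<close> yields the bound.
  Rogers-Shephard follows from monotonicity of \<open>V\<close>: if \<open>T\<close> is an inscribed triangle of largest area, then
  \<open>- A\<close> lies in a translate of \<open>2 T\<close>, so \<open>V A (- A) \<le> 2 V A T \<le> 2 |A|\<close>. Equality forces \<open>A\<close> and \<open>C\<close> to be
  triangles, for which \<open>F\<close> is explicit and the claim becomes a determinant inequality.

  Bilinearity of \<open>V\<close> is read off from an integral formula for the area. Sweep a body by its
  supporting lines of slope \<open>- p\<close>, and let \<open>kappa p\<close> be the horizontal distance from the point of contact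
  to the side of the bounding box that it approaches as \<open>|p|\<close> grows. Then the bounding box exceeds
  the body by half the integral of \<open>kappa\<^sup>2\<close>, taken over the upper and the lower boundary, and \<open>kappa\<close>
  is additive under Minkowski sums.
\<close>

section \<open>Support functions and slices\<close>

abbreviation vec2 :: "real \<Rightarrow> real \<Rightarrow> real^2" where
  "vec2 x y \<equiv> vector [x, y]"

lemma inner_2: "(x::real^2) \<bullet> y = x$1 * y$1 + x$2 * y$2"
  by (simp add: inner_vec_def sum_2)

lemma vec_eq_2: "(x::real^2) = y \<longleftrightarrow> x$1 = y$1 \<and> x$2 = y$2"
  by (simp add: vec_eq_iff forall_2)

lemma vec2_components [simp]: "vec2 (x$1) (x$2) = x"
  by (simp add: vec_eq_2)

definition convex_body :: "'a::euclidean_space set \<Rightarrow> bool" where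
  "convex_body X \<longleftrightarrow> compact X \<and> convex X \<and> X \<noteq> {}"

definition supp :: "'a::euclidean_space set \<Rightarrow> 'a \<Rightarrow> real" where
  "supp X u = (SUP x\<in>X. x \<bullet> u)"

definition face :: "'a::euclidean_space set \<Rightarrow> 'a \<Rightarrow> 'a set" where
  "face X u = {x \<in> X. x \<bullet> u = supp X u}"

lemma supp_eqI:
  assumes "x \<in> X" "x \<bullet> u = c" "\<And>y. y \<in> X \<Longrightarrow> y \<bullet> u \<le> c"
  shows "supp X u = c"
  unfolding supp_def using assms by (intro cSup_eq_maximum) auto

lemma supp_attained:
  assumes "compact X" "X \<noteq> {}"
  obtains x where "x \<in> X" "x \<bullet> u = supp X u"
proof -
  obtain x where "x \<in> X" "\<forall>y\<in>X. y \<bullet> u \<le> x \<bullet> u"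
    using continuous_attains_sup[OF assms continuous_on_inner[OF continuous_on_id continuous_on_const]]
    by blast
  then show ?thesis using that supp_eqI by metis
qed

lemma supp_ge:
  assumes "compact X" "x \<in> X"
  shows "x \<bullet> u \<le> supp X u"
proof -
  obtain z where "z \<in> X" "\<forall>y\<in>X. y \<bullet> u \<le> z \<bullet> u"
    using continuous_attains_sup[OF assms(1) _ continuous_on_inner[OF continuous_on_id continuous_on_const]]
      assms(2) by blast
  then show ?thesis using supp_eqI assms by metis
qed

lemma supp_le:
  assumes "compact X" "X \<noteq> {}" "\<And>x. x \<in> X \<Longrightarrow> x \<bullet> u \<le> c"
  shows "supp X u \<le> c"
  using supp_attained assms by metis

lemma mem_face: "x \<in> face X u \<longleftrightarrow> x \<in> X \<and> x \<bullet> u = supp X u"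
  by (simp add: face_def)

lemma compact_face: "compact X \<Longrightarrow> compact (face X u)"
proof -
  assume "compact X"
  moreover have "closed {x. x \<bullet> u = supp X u}"
    by (intro closed_Collect_eq continuous_intros)
  moreover have "face X u = X \<inter> {x. x \<bullet> u = supp X u}" by (auto simp: face_def)
  ultimately show ?thesis by (simp add: compact_Int_closed)
qed

lemma face_nonempty: "compact X \<Longrightarrow> X \<noteq> {} \<Longrightarrow> face X u \<noteq> {}"
  using supp_attained mem_face by (metis empty_iff)

lemma convex_body_sum:
  assumes "convex_body X" "convex_body Y"
  shows "convex_body (minkowski_sum X Y)"
proof -
  have "minkowski_sum X Y = (\<Union>x\<in>X. \<Union>y\<in>Y. {x + y})"
    by (auto simp: minkowski_sum_def)
  then show ?thesis
    using assms convex_sums[of X Y] compact_sums'[of X Y] by (auto simp: convex_body_def)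
qed

lemma minkowski_sum_mono: "X \<subseteq> X' \<Longrightarrow> Y \<subseteq> Y' \<Longrightarrow> minkowski_sum X Y \<subseteq> minkowski_sum X' Y'"
  by (auto simp: minkowski_sum_def)

lemma minkowski_sum_linear_image:
  assumes "linear f"
  shows "minkowski_sum (f ` X) (f ` Y) = f ` minkowski_sum X Y"
proof -
  interpret linear f by fact
  show ?thesis unfolding minkowski_sum_def by (force simp: add)
qed

lemma supp_sum:
  assumes "convex_body X" "convex_body Y"
  shows "supp (minkowski_sum X Y) u = supp X u + supp Y u"
proof -
  obtain x y where "x \<in> X" "x \<bullet> u = supp X u" "y \<in> Y" "y \<bullet> u = supp Y u"
    using supp_attained assms unfolding convex_body_def by metis
  then show ?thesis
    using assms unfolding convex_body_def
    by (intro supp_eqI[of "x + y"])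
      (auto simp: minkowski_sum_def inner_add_left intro!: add_mono supp_ge)
qed

text \<open>Each summand is bounded by its own support value, so a sum reaches the total only if
  both summands are extremal. Additivity of \<open>ext\<close> and \<open>kappa\<close> rests on
  this.\<close>

lemma face_sum:
  assumes "convex_body X" "convex_body Y"
  shows "face (minkowski_sum X Y) u = minkowski_sum (face X u) (face Y u)"
proof -
  have "x \<bullet> u = supp X u \<and> y \<bullet> u = supp Y u"
    if "x \<in> X" "y \<in> Y" "(x + y) \<bullet> u = supp X u + supp Y u" for x y
    using that assms supp_ge[of X x u] supp_ge[of Y y u]
    by (auto simp: convex_body_def inner_add_left)
  then show ?thesis
    unfolding face_def supp_sum[OF assms]
    by (fastforce simp: minkowski_sum_def inner_add_left)
qed

lemma convex_body_face:
  assumes "convex_body X"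
  shows "convex_body (face X u)"
proof -
  have "face X u = X \<inter> {x. u \<bullet> x = supp X u}" by (auto simp: face_def inner_commute)
  then have "convex (face X u)"
    using assms by (auto simp: convex_body_def intro!: convex_Int convex_hyperplane)
  then show ?thesis
    using assms compact_face face_nonempty by (auto simp: convex_body_def)
qed

lemma convex_body_linear_image:
  assumes "convex_body X" "linear f"
  shows "convex_body (f ` X)"
  using assms by (auto simp: convex_body_def convex_linear_image compact_continuous_image
      linear_continuous_on linear_linear)

lemma convex_body_scale: "convex_body X \<Longrightarrow> convex_body ((*\<^sub>R) s ` X)"
  by (rule convex_body_linear_image) auto

lemma convex_body_uminus: "convex_body X \<Longrightarrow> convex_body (uminus ` X)"
  by (rule convex_body_linear_image) (auto intro: linearI)

lemma convex_body_singleton: "convex_body {b}"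
  by (simp add: convex_body_def)

lemma supp_scale:
  assumes "convex_body X" "0 \<le> s"
  shows "supp ((*\<^sub>R) s ` X) u = s * supp X u"
proof -
  obtain x where "x \<in> X" "x \<bullet> u = supp X u"
    using supp_attained assms unfolding convex_body_def by metis
  then show ?thesis
    using assms unfolding convex_body_def
    by (intro supp_eqI[of "s *\<^sub>R x"]) (auto intro!: mult_left_mono supp_ge)
qed

lemma supp_uminus:
  assumes "convex_body X"
  shows "supp (uminus ` X) u = supp X (- u)"
proof -
  obtain x where "x \<in> X" "x \<bullet> (- u) = supp X (- u)"
    using supp_attained assms unfolding convex_body_def by metis
  then show ?thesis
    using assms supp_ge[of X _ "- u"] unfolding convex_body_def
    by (intro supp_eqI[of "- x"]) auto
qed

lemma supp_singleton [simp]: "supp {b} u = b \<bullet> u"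
  by (intro supp_eqI[of b]) auto

text \<open>The hypothesis makes \<open>F\<close> convex with \<open>e\<close> choosing a
  subgradient at each point, so this is a fundamental theorem of calculus without differentiability.
  The defect \<open>G\<close> varies over an interval by at most its length times the increment of
  \<open>e\<close>; over \<open>n\<close> equal pieces these increments telescope, which leaves a
  bound of order \<open>1 / n\<close>.\<close>

lemma mono_selection_has_integral:
  fixes e F :: "real \<Rightarrow> real"
  assumes subgrad: "\<And>p q. (q - p) * e p \<le> F q - F p" and "p \<le> q"
  shows "(e has_integral F q - F p) {p..q}"
proof -
  have mono: "e x \<le> e y" if "x \<le> y" for x y
  proof (cases "x = y")
    case False
    have "(y - x) * e x \<le> (y - x) * e y"
      using subgrad[where p=x and q=y] subgrad[where p=y and q=x] by (simp add: algebra_simps)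
    then show ?thesis using that False by simp
  qed simp
  have int: "e integrable_on {x..y}" for x y
    by (rule integrable_on_mono_on) (auto intro: mono_onI mono)
  define G where "G x = F x - integral {p..x} e" for x
  have step: "\<bar>G y - G x\<bar> \<le> (y - x) * (e y - e x)" if "p \<le> x" "x \<le> y" for x y
  proof -
    have "integral {p..y} e = integral {p..x} e + integral {x..y} e"
      using that int by (simp add: Henstock_Kurzweil_Integration.integral_combine)
    moreover have "(y - x) * e x \<le> integral {x..y} e"
      using integral_le[of "\<lambda>_. e x" "{x..y}" e] that int mono by (simp add: integrable_const_ivl)
    moreover have "integral {x..y} e \<le> (y - x) * e y"
      using integral_le[of e "{x..y}" "\<lambda>_. e y"] that int mono by (simp add: integrable_const_ivl)
    moreover have "(y - x) * e x \<le> F y - F x" "F y - F x \<le> (y - x) * e y"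
      using subgrad[where p=x and q=y] subgrad[where p=y and q=x] by (simp_all add: algebra_simps)
    ultimately show ?thesis unfolding G_def by (simp add: algebra_simps)
  qed
  have bound: "\<bar>G q - G p\<bar> \<le> (q - p) * (e q - e p) / real n" if "n > 0" for n :: nat
  proof -
    define h where "h = (q - p) / real n"
    have "h \<ge> 0" using assms by (simp add: h_def)
    have "\<bar>G (p + real k * h) - G p\<bar> \<le> h * (e (p + real k * h) - e p)" for k :: nat
    proof (induction k)
      case (Suc k)
      have "p + real (Suc k) * h - (p + real k * h) = h" by (simp add: algebra_simps)
      then have "\<bar>G (p + real (Suc k) * h) - G (p + real k * h)\<bar>
          \<le> h * (e (p + real (Suc k) * h) - e (p + real k * h))"
        using step[of "p + real k * h" "p + real (Suc k) * h"] \<open>h \<ge> 0\<close>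
        by (simp add: mult_right_mono)
      with Suc.IH show ?case by (simp add: algebra_simps)
    qed simp
    from this[of n] show ?thesis using that by (simp add: h_def)
  qed
  have "\<bar>G q - G p\<bar> \<le> 0"
  proof (rule field_le_epsilon)
    fix \<epsilon> :: real assume "0 < \<epsilon>"
    obtain n :: nat where n: "(q - p) * (e q - e p) / \<epsilon> < real n" using reals_Archimedean2 by blast
    have "(q - p) * (e q - e p) / real (Suc n) \<le> \<epsilon>"
      using n \<open>0 < \<epsilon>\<close> by (simp add: field_simps)
    then show "\<bar>G q - G p\<bar> \<le> 0 + \<epsilon>" using bound[of "Suc n"] by simp
  qed
  then have "integral {p..q} e = F q - F p" by (simp add: G_def)
  then show ?thesis using int by (metis integrable_integral)
qed

section \<open>Planar Lebesgue measure by vertical slices\<close>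

lemma measurable_vec2 [measurable]:
  "(\<lambda>(x, y). vec2 x y) \<in> borel_measurable (lborel \<Otimes>\<^sub>M lborel)"
proof -
  have "continuous_on UNIV (\<lambda>z :: real \<times> real. vec2 (fst z) (snd z))"
    by (subst continuous_on_componentwise)
      (auto simp: Basis_vec_def inner_axis forall_2 intro!: continuous_intros)
  then show ?thesis
    unfolding lborel_prod by (simp add: borel_measurable_continuous_onI case_prod_unfold)
qed

text \<open>Identifies the plane with a product space so that Fubini applies; agreement on boxes
  determines the measure.\<close>

lemma lborel_vec2: "(lborel :: (real^2) measure) = distr (lborel \<Otimes>\<^sub>M lborel) borel (\<lambda>(x, y). vec2 x y)"
proof (rule lborel_eqI)
  fix l u :: "real^2"
  assume le: "\<And>b. b \<in> Basis \<Longrightarrow> l \<bullet> b \<le> u \<bullet> b"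
  have le2: "l$1 \<le> u$1" "l$2 \<le> u$2"
    using le[of "axis 1 1"] le[of "axis 2 1"] by (auto simp: Basis_vec_def inner_axis)
  have "emeasure (distr (lborel \<Otimes>\<^sub>M lborel) borel (\<lambda>(x, y). vec2 x y)) (box l u)
     = emeasure (lborel \<Otimes>\<^sub>M lborel) ({l$1<..<u$1} \<times> {l$2<..<u$2})"
    by (subst emeasure_distr[OF measurable_vec2])
      (auto simp: mem_box_cart forall_2 space_pair_measure intro!: arg_cong2[where f=emeasure])
  also have "\<dots> = ennreal (u$1 - l$1) * ennreal (u$2 - l$2)"
    using le2 by (simp add: lborel.emeasure_pair_measure_Times)
  also have "\<dots> = (\<Prod>b\<in>Basis. (u - l) \<bullet> b)"
  proof -
    have B: "(Basis :: (real^2) set) = {axis 1 1, axis 2 1}"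
      by (auto simp: Basis_vec_def UNIV_2)
    have "(\<Prod>b\<in>Basis. (u - l) \<bullet> b) = (u$1 - l$1) * (u$2 - l$2)"
      unfolding B by (simp add: axis_eq_axis inner_axis)
    then show ?thesis using le2 by (simp add: ennreal_mult)
  qed
  finally show "emeasure (distr (lborel \<Otimes>\<^sub>M lborel) borel (\<lambda>(x, y). vec2 x y)) (box l u)
     = (\<Prod>b\<in>Basis. (u - l) \<bullet> b)" .
qed simp

lemma emeasure_slices:
  assumes "X \<in> sets borel"
  shows "emeasure (lborel :: (real^2) measure) X = (\<integral>\<^sup>+s. emeasure lborel {y. vec2 s y \<in> X} \<partial>lborel)"
proof -
  have "emeasure (lborel :: (real^2) measure) X
      = emeasure (lborel \<Otimes>\<^sub>M lborel) ((\<lambda>(x, y). vec2 x y) -` X \<inter> space (lborel \<Otimes>\<^sub>M lborel))"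
    using assms by (subst lborel_vec2, subst emeasure_distr) auto
  also have "\<dots> = (\<integral>\<^sup>+s. emeasure lborel (Pair s -` ((\<lambda>(x, y). vec2 x y) -` X \<inter> space (lborel \<Otimes>\<^sub>M lborel))) \<partial>lborel)"
    by (rule lborel.emeasure_pair_measure_alt) (rule measurable_sets[OF measurable_vec2 assms])
  also have "\<dots> = (\<integral>\<^sup>+s. emeasure lborel {y. vec2 s y \<in> X} \<partial>lborel)"
    by (intro nn_integral_cong arg_cong2[where f=emeasure]) (auto simp: space_pair_measure)
  finally show ?thesis .
qed

section \<open>An integral formula for the area\<close>

text \<open>Abscissa of the rightmost contact point with the supporting line of outer normal
  \<open>(p, 1)\<close>. Taking the rightmost point selects one subgradient of
  \<open>supp X (vec2 p 1)\<close> in \<open>p\<close> even where the contact is a whole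
  edge.\<close>

definition ext :: "(real^2) set \<Rightarrow> real \<Rightarrow> real" where
  "ext X p = supp (face X (vec2 p 1)) (vec2 1 0)"

text \<open>Measuring to the side that the contact point approaches makes the square integrable over
  all \<open>p\<close>, and the expression stays additive in \<open>X\<close>.\<close>

definition kappa :: "(real^2) set \<Rightarrow> real \<Rightarrow> real" where
  "kappa X p = (if 0 \<le> p then supp X (vec2 1 0) - ext X p else ext X p + supp X (vec2 (-1) 0))"

lemma minus_vec2 [simp]: "- vec2 a b = vec2 (- a) (- b)"
  by (simp add: vec_eq_2)

text \<open>Reflection in the horizontal axis exchanges upper and lower boundary, so only upper
  boundaries have to be analysed.\<close>

definition flip :: "(real^2) set \<Rightarrow> (real^2) set" where
  "flip X = (\<lambda>x. vec2 (x$1) (- x$2)) ` X"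

lemma convex_body_flip: "convex_body X \<Longrightarrow> convex_body (flip X)"
  unfolding flip_def
  by (rule convex_body_linear_image) (auto intro!: linearI simp: vec_eq_2)

lemma vec2_mem_flip: "vec2 x y \<in> flip X \<longleftrightarrow> vec2 x (- y) \<in> X"
proof
  assume "vec2 x (- y) \<in> X"
  then show "vec2 x y \<in> flip X"
    unfolding flip_def by (intro image_eqI[of _ _ "vec2 x (- y)"]) auto
next
  assume "vec2 x y \<in> flip X"
  then obtain z where "z \<in> X" "vec2 x y = vec2 (z$1) (- z$2)" by (auto simp: flip_def)
  then have "vec2 x (- y) = z" by (simp add: vec_eq_2)
  with \<open>z \<in> X\<close> show "vec2 x (- y) \<in> X" by simp
qed

lemma flip_sum: "flip (minkowski_sum X Y) = minkowski_sum (flip X) (flip Y)"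
  unfolding flip_def
  by (subst minkowski_sum_linear_image) (auto intro!: linearI simp: vec_eq_2)

lemma flip_scale: "flip ((*\<^sub>R) s ` X) = (*\<^sub>R) s ` flip X"
  by (auto simp: flip_def image_image vec_eq_2 intro!: image_cong)

lemma supp_flip:
  assumes "convex_body X"
  shows "supp (flip X) (vec2 a b) = supp X (vec2 a (- b))"
proof -
  obtain x where "x \<in> X" "x \<bullet> vec2 a (- b) = supp X (vec2 a (- b))"
    using supp_attained assms unfolding convex_body_def by metis
  then show ?thesis
    using assms supp_ge[of X _ "vec2 a (- b)"] unfolding convex_body_def
    by (intro supp_eqI[of "vec2 (x$1) (- x$2)"]) (auto simp: flip_def inner_2)
qed

lemma supp_attained_1:
  assumes "convex_body X"
  shows "\<exists>x\<in>X. x$1 = supp X (vec2 1 0)" "\<exists>x\<in>X. x$1 = - supp X (vec2 (-1) 0)"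
proof -
  have "compact X" "X \<noteq> {}" using assms by (auto simp: convex_body_def)
  then obtain x y where "x \<in> X" "x \<bullet> vec2 1 0 = supp X (vec2 1 0)"
    and "y \<in> X" "y \<bullet> vec2 (-1) 0 = supp X (vec2 (-1) 0)"
    using supp_attained by metis
  then show "\<exists>x\<in>X. x$1 = supp X (vec2 1 0)" "\<exists>x\<in>X. x$1 = - supp X (vec2 (-1) 0)"
    by (simp_all add: inner_2 bexI[of _ x] bexI[of _ y])
qed

lemma ext_attained:
  assumes "convex_body X"
  obtains y where "vec2 (ext X p) y \<in> X" "p * ext X p + y = supp X (vec2 p 1)"
proof -
  have "convex_body (face X (vec2 p 1))" using assms by (rule convex_body_face)
  then obtain x where "x \<in> face X (vec2 p 1)" "x \<bullet> vec2 1 0 = ext X p"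
    unfolding ext_def convex_body_def using supp_attained by metis
  moreover from this have "vec2 (ext X p) (x$2) = x" by (simp add: vec_eq_2 inner_2)
  ultimately show ?thesis
    using that[of "x$2"] by (auto simp: inner_2 mem_face algebra_simps)
qed

lemma ext_bounds:
  assumes "convex_body X"
  shows "ext X p \<le> supp X (vec2 1 0)" "- supp X (vec2 (-1) 0) \<le> ext X p"
proof -
  obtain y where y: "vec2 (ext X p) y \<in> X" using ext_attained assms by metis
  with supp_ge[of X _ "vec2 1 0"] supp_ge[of X _ "vec2 (-1) 0"] assms
  show "ext X p \<le> supp X (vec2 1 0)" "- supp X (vec2 (-1) 0) \<le> ext X p"
    by (fastforce simp: convex_body_def inner_2)+
qed

lemma ext_subgradient:
  assumes "convex_body X"
  shows "(q - p) * ext X p \<le> supp X (vec2 q 1) - supp X (vec2 p 1)"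
proof -
  obtain y where y: "vec2 (ext X p) y \<in> X" "p * ext X p + y = supp X (vec2 p 1)"
    using ext_attained assms by metis
  with supp_ge[of X "vec2 (ext X p) y" "vec2 q 1"] assms
  show ?thesis by (simp add: convex_body_def inner_2 algebra_simps)
qed

lemma ext_has_integral:
  assumes "convex_body X" "p \<le> q"
  shows "(ext X has_integral supp X (vec2 q 1) - supp X (vec2 p 1)) {p..q}"
  by (rule mono_selection_has_integral) (use assms ext_subgradient in auto)

text \<open>Each contact point is extremal for its own direction; adding the two inequalities gives
  \<open>(q - p) * (ext X q - s) >= 0\<close>. For \<open>p = q\<close> the rightmost choice in
  \<open>ext\<close> decides, hence the strict and the weak hypothesis.\<close>

lemma ext_between:
  assumes "convex_body X" "vec2 s y \<in> face X (vec2 p 1)"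
  shows "q < p \<Longrightarrow> ext X q \<le> s" "p \<le> q \<Longrightarrow> s \<le> ext X q"
proof -
  have s: "vec2 s y \<in> X" "p * s + y = supp X (vec2 p 1)"
    using assms(2) by (auto simp: mem_face inner_2 algebra_simps)
  obtain z where z: "vec2 (ext X q) z \<in> X" "q * ext X q + z = supp X (vec2 q 1)"
    using ext_attained assms(1) by metis
  have "q * s + y \<le> q * ext X q + z" "p * ext X q + z \<le> p * s + y"
    using supp_ge[of X "vec2 s y" "vec2 q 1"] supp_ge[of X "vec2 (ext X q) z" "vec2 p 1"] s z assms
    by (auto simp: convex_body_def inner_2 algebra_simps)
  then have *: "0 \<le> (q - p) * (ext X q - s)" by (simp add: algebra_simps)
  show "ext X q \<le> s" if "q < p"
    using * that by (simp add: zero_le_mult_iff)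
  show "s \<le> ext X q" if "p \<le> q"
  proof (cases "p = q")
    case True
    then have "s \<le> supp (face X (vec2 q 1)) (vec2 1 0)"
      using supp_ge[of "face X (vec2 q 1)" "vec2 s y" "vec2 1 0"] assms
      by (simp add: inner_2 convex_body_def compact_face)
    then show ?thesis by (simp add: ext_def)
  next
    case False
    then show ?thesis using * that by (simp add: zero_le_mult_iff)
  qed
qed

lemma ext_mono:
  assumes "convex_body X" "p \<le> q"
  shows "ext X p \<le> ext X q"
proof -
  obtain y where "vec2 (ext X p) y \<in> X" "p * ext X p + y = supp X (vec2 p 1)"
    using ext_attained assms by metis
  then have "vec2 (ext X p) y \<in> face X (vec2 p 1)" by (simp add: mem_face inner_2 algebra_simps)
  then show ?thesis using ext_between(2) assms by blast
qed

lemma ext_measurable [measurable]: "convex_body X \<Longrightarrow> ext X \<in> borel_measurable borel"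
  by (rule borel_measurable_mono) (auto intro: monoI ext_mono)

lemma kappa_measurable [measurable]: "convex_body X \<Longrightarrow> kappa X \<in> borel_measurable borel"
  unfolding kappa_def by measurable

lemma ext_sum:
  assumes "convex_body X" "convex_body Y"
  shows "ext (minkowski_sum X Y) p = ext X p + ext Y p"
  unfolding ext_def using assms by (simp add: face_sum supp_sum convex_body_face)

lemma ext_scale:
  assumes "convex_body X" "0 \<le> s"
  shows "ext ((*\<^sub>R) s ` X) p = s * ext X p"
proof (cases "s = 0")
  case True
  then have "(*\<^sub>R) s ` X = {0}" using assms by (auto simp: convex_body_def)
  moreover have "face {0::real^2} u = {0}" for u by (auto simp: face_def)
  ultimately show ?thesis using True by (simp add: ext_def)
next
  case False
  then have "face ((*\<^sub>R) s ` X) u = (*\<^sub>R) s ` face X u" for u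
    using assms by (auto simp: face_def supp_scale)
  then show ?thesis using assms by (simp add: ext_def supp_scale convex_body_face)
qed

lemma kappa_sum:
  assumes "convex_body X" "convex_body Y"
  shows "kappa (minkowski_sum X Y) p = kappa X p + kappa Y p"
  using assms by (simp add: kappa_def ext_sum supp_sum)

lemma kappa_scale:
  assumes "convex_body X" "0 \<le> s"
  shows "kappa ((*\<^sub>R) s ` X) p = s * kappa X p"
  using assms by (simp add: kappa_def ext_scale supp_scale algebra_simps)

section \<open>The gap between a body and its bounding box\<close>

text \<open>Kernel for a double count: integrated over \<open>p\<close> it gives the height of the
  gap above the body at abscissa \<open>s\<close>, integrated over \<open>s\<close> it gives half of
  \<open>kappa\<close> squared.\<close>

definition gap_kernel :: "(real^2) set \<Rightarrow> real \<Rightarrow> real \<Rightarrow> real" where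
  "gap_kernel X p s = (if 0 \<le> p then max 0 (s - ext X p) else max 0 (ext X p - s))"

lemma upper_supporting_line:
  assumes X: "convex_body X"
    and s: "- supp X (vec2 (-1) 0) < s" "s < supp X (vec2 1 0)"
    and top: "vec2 s g \<in> X" "\<And>y. vec2 s y \<in> X \<Longrightarrow> y \<le> g"
  obtains p where "vec2 s g \<in> face X (vec2 p 1)"
proof -
  \<comment> \<open>The open vertical ray above the top point of the slice misses \<open>X\<close>,
    so a line separates the two.\<close>
  define R where "R = {x :: real^2. x$1 = s \<and> g < x$2}"
  have "convex R"
  proof -
    have "R = {x. vec2 1 0 \<bullet> x = s} \<inter> {x. vec2 0 1 \<bullet> x > g}" by (auto simp: R_def inner_2)
    then show ?thesis by (simp add: convex_Int convex_hyperplane convex_halfspace_gt)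
  qed
  moreover have "vec2 s (g + 1) \<in> R" by (simp add: R_def)
  moreover have "X \<inter> R = {}"
  proof (rule ccontr)
    assume "X \<inter> R \<noteq> {}"
    then obtain x where "x \<in> X" "x$1 = s" "g < x$2" by (auto simp: R_def)
    then show False using top(2)[of "x$2"] vec2_components[of x] by auto
  qed
  ultimately obtain u b where u: "u \<noteq> 0" "\<And>x. x \<in> X \<Longrightarrow> u \<bullet> x \<le> b" "\<And>x. x \<in> R \<Longrightarrow> b \<le> u \<bullet> x"
    using separating_hyperplane_sets[of X R] X unfolding convex_body_def
    by (metis empty_iff)
  have ray: "b \<le> u$1 * s + u$2 * (g + \<epsilon>)" if "\<epsilon> > 0" for \<epsilon>
    using u(3)[of "vec2 s (g + \<epsilon>)"] that by (simp add: R_def inner_2)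
  have gb: "u$1 * s + u$2 * g \<le> b" using u(2)[OF top(1)] by (simp add: inner_2)
  have u2: "0 \<le> u$2" using ray[of 1] gb by (simp add: algebra_simps)
  \<comment> \<open>Letting the point of the ray descend to the top point shows that the separating
    line passes through it. The divisor \<open>u$2 + 1\<close> stays positive even if
    \<open>u$2\<close> vanishes.\<close>
  have bg: "b \<le> u$1 * s + u$2 * g"
  proof (rule field_le_epsilon)
    fix \<epsilon> :: real assume "\<epsilon> > 0"
    have "u$2 * (\<epsilon> / (u$2 + 1)) \<le> \<epsilon>"
      using u2 \<open>\<epsilon> > 0\<close> by (simp add: field_simps)
    with ray[of "\<epsilon> / (u$2 + 1)"] u2 \<open>\<epsilon> > 0\<close> show "b \<le> u$1 * s + u$2 * g + \<epsilon>"
      by (simp add: distrib_left)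
  qed
  \<comment> \<open>A vertical separating line would leave \<open>X\<close> on one side of the
    abscissa \<open>s\<close>, but \<open>s\<close> lies strictly inside the horizontal range of
    \<open>X\<close>.\<close>
  have "u$2 \<noteq> 0"
  proof
    assume u20: "u$2 = 0"
    obtain x where x: "x \<in> X" "x$1 = supp X (vec2 1 0)"
      using supp_attained_1(1) X by metis
    obtain z where z: "z \<in> X" "z$1 = - supp X (vec2 (-1) 0)"
      using supp_attained_1(2) X by metis
    have "u$1 * x$1 \<le> u$1 * s" "u$1 * z$1 \<le> u$1 * s"
      using u(2)[OF x(1)] u(2)[OF z(1)] bg u20 by (simp_all add: inner_2)
    then have "u$1 * (x$1 - s) \<le> 0" "0 \<le> u$1 * (s - z$1)"
      by (simp_all add: right_diff_distrib)
    moreover have "0 < x$1 - s" "0 < s - z$1" using s x z by simp_all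
    ultimately have "u$1 = 0"
      by (metis mult_le_0_iff zero_le_mult_iff not_less order_antisym)
    with u20 u(1) show False by (simp add: vec_eq_2)
  qed
  with u2 have u2: "u$2 > 0" by simp
  have "y \<bullet> vec2 (u$1 / u$2) 1 \<le> vec2 s g \<bullet> vec2 (u$1 / u$2) 1" if "y \<in> X" for y
  proof -
    have eq: "z \<bullet> vec2 (u$1 / u$2) 1 = (u \<bullet> z) / u$2" for z
      using u2 by (simp add: inner_2 field_simps)
    have "u \<bullet> y \<le> u \<bullet> vec2 s g"
      using u(2)[OF that] bg by (simp add: inner_2)
    then show ?thesis unfolding eq using u2 by (simp add: divide_right_mono)
  qed
  then have "vec2 s g \<in> face X (vec2 (u$1 / u$2) 1)"
    using top(1) supp_eqI unfolding mem_face by metis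
  then show ?thesis by (rule that)
qed

text \<open>\<open>ext X\<close> passes the level \<open>s\<close> at \<open>p0\<close>, so the
  kernel lives between \<open>0\<close> and \<open>p0\<close>. There it is the difference of
  \<open>s\<close> and \<open>ext X\<close> up to sign, whose integral telescopes to values of the
  support function at \<open>0\<close> and \<open>p0\<close>; the latter is known from the contact
  point.\<close>

lemma upper_gap:
  assumes X: "convex_body X" and p0: "vec2 s g \<in> face X (vec2 p0 1)"
  shows "(\<integral>\<^sup>+p. ennreal (gap_kernel X p s) \<partial>lborel) = ennreal (supp X (vec2 0 1) - g)"
proof -
  have g: "p0 * s + g = supp X (vec2 p0 1)"
    using p0 by (simp add: mem_face inner_2 algebra_simps)
  note below = ext_between(1)[OF X p0] and above = ext_between(2)[OF X p0]
  have *: "(\<integral>\<^sup>+p. ennreal (gap_kernel X p s) \<partial>lborel) = ennreal I"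
    if "((\<lambda>p. gap_kernel X p s) has_integral I) {l..u}"
      and "\<And>p. p \<notin> {l..u} \<Longrightarrow> gap_kernel X p s = 0" for I l u
  proof -
    have "(\<integral>\<^sup>+p. ennreal (gap_kernel X p s) \<partial>lborel)
        = (\<integral>\<^sup>+p. ennreal (gap_kernel X p s) * indicator {l..u} p \<partial>lborel)"
      using that(2) by (intro nn_integral_cong) (auto simp: indicator_def)
    also have "\<dots> = ennreal I"
      using that(1) by (intro nn_integral_has_integral_lebesgue') (auto simp: gap_kernel_def)
    finally show ?thesis .
  qed
  show ?thesis
  proof (cases "0 \<le> p0")
    case True
    have "((\<lambda>p. s - ext X p) has_integral (p0 - 0) * s - (supp X (vec2 p0 1) - supp X (vec2 0 1))) {0..p0}"
      using has_integral_const_real[of s 0 p0] True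
      by (intro has_integral_diff ext_has_integral[OF X]) auto
    then have "((\<lambda>p. gap_kernel X p s) has_integral (p0 - 0) * s - (supp X (vec2 p0 1) - supp X (vec2 0 1))) {0..p0}"
      \<comment> \<open>At \<open>p0\<close> itself \<open>ext\<close> takes the right end of the
        face and may exceed \<open>s\<close>.\<close>
      by (rule has_integral_spike_finite[of "{p0}", rotated 2])
        (use below in \<open>auto simp: gap_kernel_def max_def\<close>)
    moreover have "gap_kernel X p s = 0" if "p \<notin> {0..p0}" for p
      using that True below[of p] above[of p] by (auto simp: gap_kernel_def)
    ultimately have "(\<integral>\<^sup>+p. ennreal (gap_kernel X p s) \<partial>lborel)
        = ennreal ((p0 - 0) * s - (supp X (vec2 p0 1) - supp X (vec2 0 1)))"
      by (rule *)
    also have "(p0 - 0) * s - (supp X (vec2 p0 1) - supp X (vec2 0 1)) = supp X (vec2 0 1) - g"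
      using g by simp
    finally show ?thesis .
  next
    case False
    have "((\<lambda>p. ext X p - s) has_integral supp X (vec2 0 1) - supp X (vec2 p0 1) - (0 - p0) * s) {p0..0}"
      using has_integral_const_real[of s p0 0] False
      by (intro has_integral_diff ext_has_integral[OF X]) auto
    then have "((\<lambda>p. gap_kernel X p s) has_integral supp X (vec2 0 1) - supp X (vec2 p0 1) - (0 - p0) * s) {p0..0}"
      \<comment> \<open>At \<open>p = 0\<close> the kernel already uses its other branch.\<close>
      by (rule has_integral_spike_finite[of "{0}", rotated 2])
        (use above in \<open>auto simp: gap_kernel_def max_def\<close>)
    moreover have "gap_kernel X p s = 0" if "p \<notin> {p0..0}" for p
      using that False below[of p] above[of p] by (auto simp: gap_kernel_def)
    ultimately have "(\<integral>\<^sup>+p. ennreal (gap_kernel X p s) \<partial>lborel)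
        = ennreal (supp X (vec2 0 1) - supp X (vec2 p0 1) - (0 - p0) * s)"
      by (rule *)
    also have "supp X (vec2 0 1) - supp X (vec2 p0 1) - (0 - p0) * s = supp X (vec2 0 1) - g"
      using g by simp
    finally show ?thesis .
  qed
qed

lemma slice_interval:
  assumes X: "convex_body X"
    and s: "- supp X (vec2 (-1) 0) \<le> s" "s \<le> supp X (vec2 1 0)"
  obtains f g where "{y. vec2 s y \<in> X} = {f..g}" "f \<le> g"
proof -
  have eq: "{y. vec2 s y \<in> X} = (\<lambda>x. x$2) ` (X \<inter> {x. vec2 1 0 \<bullet> x = s})"
  proof (intro equalityI subsetI)
    fix y assume "y \<in> {y. vec2 s y \<in> X}"
    then show "y \<in> (\<lambda>x. x$2) ` (X \<inter> {x. vec2 1 0 \<bullet> x = s})"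
      by (intro image_eqI[of _ _ "vec2 s y"]) (auto simp: inner_2)
  next
    fix y assume "y \<in> (\<lambda>x. x$2) ` (X \<inter> {x. vec2 1 0 \<bullet> x = s})"
    then obtain x where "x \<in> X" "x$1 = s" "x$2 = y" by (auto simp: inner_2)
    moreover from this have "vec2 s y = x" by (simp add: vec_eq_2)
    ultimately show "y \<in> {y. vec2 s y \<in> X}" by simp
  qed
  have "convex ((\<lambda>x. x$2) ` (X \<inter> {x. vec2 1 0 \<bullet> x = s}))"
    using X by (intro convex_linear_image)
      (auto simp: convex_body_def intro!: convex_Int convex_hyperplane linearI)
  moreover have "compact ((\<lambda>x. x$2) ` (X \<inter> {x. vec2 1 0 \<bullet> x = s}))"
    using X by (intro compact_continuous_image)
      (auto simp: convex_body_def intro!: compact_Int_closed closed_hyperplane continuous_intros)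
  ultimately obtain f g where fg: "{y. vec2 s y \<in> X} = {f..g}"
    unfolding eq using connected_compact_interval_1 convex_connected by metis
  obtain x where x: "x \<in> X" "x$1 = supp X (vec2 1 0)"
    using supp_attained_1(1) X by metis
  obtain z where z: "z \<in> X" "z$1 = - supp X (vec2 (-1) 0)"
    using supp_attained_1(2) X by metis
  have "convex ((\<lambda>x. x$1) ` X)"
    using X by (intro convex_linear_image) (auto simp: convex_body_def intro!: linearI)
  then have "s \<in> (\<lambda>x. x$1) ` X"
    using connected_contains_Icc[OF convex_connected imageI[OF z(1)] imageI[OF x(1)]] x(2) z(2) s
    by fastforce
  then obtain v where "v \<in> X" "v$1 = s" by auto
  then have "v$2 \<in> {f..g}" using fg by (metis mem_Collect_eq vec2_components)
  then show ?thesis using that fg by auto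
qed

text \<open>The vertical line at \<open>s\<close> crosses the bounding box in the gap below, the
  slice and the gap above; the gap below is the upper gap of the flipped body.\<close>

lemma slice_measure:
  assumes X: "convex_body X"
    and s: "- supp X (vec2 (-1) 0) < s" "s < supp X (vec2 1 0)"
  shows "emeasure lborel {y. vec2 s y \<in> X} + (\<integral>\<^sup>+p. ennreal (gap_kernel X p s) \<partial>lborel)
      + (\<integral>\<^sup>+p. ennreal (gap_kernel (flip X) p s) \<partial>lborel)
      = ennreal (supp X (vec2 0 1) + supp X (vec2 0 (-1)))"
proof -
  obtain f g where fg: "{y. vec2 s y \<in> X} = {f..g}" "f \<le> g"
    using slice_interval[OF X, of s] s by auto
  have mem: "vec2 s y \<in> X \<longleftrightarrow> f \<le> y \<and> y \<le> g" for y using fg by auto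
  obtain p where p: "vec2 s g \<in> face X (vec2 p 1)"
    using upper_supporting_line[OF X s, of g] mem fg by auto
  obtain q where q: "vec2 s (- f) \<in> face (flip X) (vec2 q 1)"
    using upper_supporting_line[OF convex_body_flip[OF X], of s "- f"] mem fg s
    by (fastforce simp: supp_flip[OF X] vec2_mem_flip)
  have "g \<le> supp X (vec2 0 1)" "- f \<le> supp X (vec2 0 (-1))"
    using supp_ge[of X "vec2 s g" "vec2 0 1"] supp_ge[of X "vec2 s f" "vec2 0 (-1)"] mem fg X
    by (auto simp: convex_body_def inner_2)
  then show ?thesis
    using fg by (simp add: upper_gap[OF X p] upper_gap[OF convex_body_flip[OF X] q]
        supp_flip[OF X] ennreal_plus[symmetric] del: ennreal_plus)
qed

lemma nn_integral_ramp:
  fixes a b c :: real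
  assumes "a \<le> c" "c \<le> b"
  shows "(\<integral>\<^sup>+s. ennreal (max 0 (s - c)) * indicator {a<..<b} s \<partial>lborel) = ennreal ((b - c)\<^sup>2 / 2)"
    "(\<integral>\<^sup>+s. ennreal (max 0 (c - s)) * indicator {a<..<b} s \<partial>lborel) = ennreal ((c - a)\<^sup>2 / 2)"
proof -
  have "((\<lambda>s. s - c) has_integral (b - c)\<^sup>2 / 2 - (c - c)\<^sup>2 / 2) {c..b}"
    using assms by (intro fundamental_theorem_of_calculus)
      (auto intro!: derivative_eq_intros simp flip: has_real_derivative_iff_has_vector_derivative)
  then have "(\<integral>\<^sup>+s. ennreal (s - c) * indicator {c..b} s \<partial>lborel) = ennreal ((b - c)\<^sup>2 / 2)"
    by (intro nn_integral_has_integral_lebesgue') auto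
  moreover have "(\<integral>\<^sup>+s. ennreal (max 0 (s - c)) * indicator {a<..<b} s \<partial>lborel)
      = (\<integral>\<^sup>+s. ennreal (s - c) * indicator {c..b} s \<partial>lborel)"
    using AE_lborel_singleton[of b] assms
    by (intro nn_integral_cong_AE) (auto elim!: eventually_mono simp: indicator_def max_def ennreal_neg)
  ultimately show "(\<integral>\<^sup>+s. ennreal (max 0 (s - c)) * indicator {a<..<b} s \<partial>lborel) = ennreal ((b - c)\<^sup>2 / 2)"
    by simp
  have "((\<lambda>s. c - s) has_integral - ((c - c)\<^sup>2 / 2) - - ((c - a)\<^sup>2 / 2)) {a..c}"
    using assms by (intro fundamental_theorem_of_calculus)
      (auto intro!: derivative_eq_intros simp: field_simps simp flip: has_real_derivative_iff_has_vector_derivative)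
  then have "(\<integral>\<^sup>+s. ennreal (c - s) * indicator {a..c} s \<partial>lborel) = ennreal ((c - a)\<^sup>2 / 2)"
    by (intro nn_integral_has_integral_lebesgue') auto
  moreover have "(\<integral>\<^sup>+s. ennreal (max 0 (c - s)) * indicator {a<..<b} s \<partial>lborel)
      = (\<integral>\<^sup>+s. ennreal (c - s) * indicator {a..c} s \<partial>lborel)"
    using AE_lborel_singleton[of a] assms
    by (intro nn_integral_cong_AE) (auto elim!: eventually_mono simp: indicator_def max_def ennreal_neg)
  ultimately show "(\<integral>\<^sup>+s. ennreal (max 0 (c - s)) * indicator {a<..<b} s \<partial>lborel) = ennreal ((c - a)\<^sup>2 / 2)"
    by simp
qed

lemma gap_kernel_measurable [measurable]:
  assumes [measurable]: "convex_body X"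
  shows "(\<lambda>(p, s). gap_kernel X p s) \<in> borel_measurable (borel \<Otimes>\<^sub>M borel)"
  unfolding gap_kernel_def by measurable

text \<open>Exchange the integrals: for fixed \<open>p\<close> the kernel is a ramp of slope one in
  absolute value, rising from the contact abscissa to the approached side at distance
  \<open>kappa X p\<close>.\<close>

lemma nn_integral_gap:
  assumes X: "convex_body X"
  shows "(\<integral>\<^sup>+s. (\<integral>\<^sup>+p. ennreal (gap_kernel X p s) \<partial>lborel)
            * indicator {- supp X (vec2 (-1) 0)<..<supp X (vec2 1 0)} s \<partial>lborel)
       = (\<integral>\<^sup>+p. ennreal ((kappa X p)\<^sup>2 / 2) \<partial>lborel)"
proof -
  note [measurable] = X
  let ?J = "{- supp X (vec2 (-1) 0)<..<supp X (vec2 1 0)}"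
  have "(\<integral>\<^sup>+s. (\<integral>\<^sup>+p. ennreal (gap_kernel X p s) \<partial>lborel) * indicator ?J s \<partial>lborel)
     = (\<integral>\<^sup>+s. (\<integral>\<^sup>+p. ennreal (gap_kernel X p s) * indicator ?J s \<partial>lborel) \<partial>lborel)"
    by (intro nn_integral_cong nn_integral_multc[symmetric]) measurable
  also have "\<dots> = (\<integral>\<^sup>+p. (\<integral>\<^sup>+s. ennreal (gap_kernel X p s) * indicator ?J s \<partial>lborel) \<partial>lborel)"
    by (rule lborel_pair.Fubini') measurable
  also have "\<dots> = (\<integral>\<^sup>+p. ennreal ((kappa X p)\<^sup>2 / 2) \<partial>lborel)"
  proof (rule nn_integral_cong)
    fix p
    show "(\<integral>\<^sup>+s. ennreal (gap_kernel X p s) * indicator ?J s \<partial>lborel) = ennreal ((kappa X p)\<^sup>2 / 2)"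
    proof (cases "0 \<le> p")
      case True
      then have "gap_kernel X p = (\<lambda>s. max 0 (s - ext X p))" "kappa X p = supp X (vec2 1 0) - ext X p"
        by (auto simp: gap_kernel_def kappa_def)
      then show ?thesis
        by (simp only: nn_integral_ramp(1)[OF ext_bounds(2,1)[OF X]])
    next
      case False
      then have "gap_kernel X p = (\<lambda>s. max 0 (ext X p - s))" "kappa X p = ext X p - - supp X (vec2 (-1) 0)"
        by (auto simp: gap_kernel_def kappa_def)
      then show ?thesis
        by (simp only: nn_integral_ramp(2)[OF ext_bounds(2,1)[OF X]])
    qed
  qed
  finally show ?thesis .
qed

lemma width_nonneg:
  assumes "convex_body X"
  shows "0 \<le> supp X u + supp X (- u)"
proof -
  obtain x where "x \<in> X" using assms by (auto simp: convex_body_def)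
  then show ?thesis
    using supp_ge[of X x u] supp_ge[of X x "- u"] assms by (auto simp: convex_body_def)
qed

text \<open>\<open>slice_measure\<close> integrated over \<open>s\<close>. As a sum of extended
  nonnegative terms with a finite value it also yields the integrability of \<open>kappa\<close>
  squared.\<close>

lemma emeasure_convex_body:
  assumes X: "convex_body X"
  shows "emeasure lborel X + (\<integral>\<^sup>+p. ennreal ((kappa X p)\<^sup>2 / 2) \<partial>lborel)
      + (\<integral>\<^sup>+p. ennreal ((kappa (flip X) p)\<^sup>2 / 2) \<partial>lborel)
      = ennreal ((supp X (vec2 1 0) + supp X (vec2 (-1) 0)) * (supp X (vec2 0 1) + supp X (vec2 0 (-1))))"
proof -
  let ?a = "- supp X (vec2 (-1) 0)" and ?b = "supp X (vec2 1 0)"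
  let ?J = "{?a<..<?b}"
  let ?H = "supp X (vec2 0 1) + supp X (vec2 0 (-1))"
  have F: "convex_body (flip X)" using X by (rule convex_body_flip)
  note [measurable] = X F
  have borel: "X \<in> sets borel" using X by (simp add: convex_body_def borel_compact)
  have [measurable]: "(\<lambda>s. emeasure lborel {y. vec2 s y \<in> X}) \<in> borel_measurable borel"
  proof -
    have "(\<lambda>s. emeasure lborel (Pair s -` ((\<lambda>(x, y). vec2 x y) -` X \<inter> space (lborel \<Otimes>\<^sub>M lborel)))) \<in> borel_measurable lborel"
      by (rule lborel.measurable_emeasure_Pair) (rule measurable_sets[OF measurable_vec2 borel])
    then show ?thesis by (simp add: space_pair_measure vimage_def)
  qed
  have out: "{y. vec2 s y \<in> X} = {}" if "s \<notin> {?a..?b}" for s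
    using supp_ge[of X "vec2 s _" "vec2 1 0"] supp_ge[of X "vec2 s _" "vec2 (-1) 0"] that X
    by (force simp: convex_body_def inner_2)
  have "emeasure lborel X = (\<integral>\<^sup>+s. emeasure lborel {y. vec2 s y \<in> X} \<partial>lborel)"
    using borel by (rule emeasure_slices)
  \<comment> \<open>A vertical edge may sit at an extreme abscissa, where no supporting line of
    finite slope need exist; these two values of \<open>s\<close> form a null set.\<close>
  also have "\<dots> = (\<integral>\<^sup>+s. emeasure lborel {y. vec2 s y \<in> X} * indicator ?J s \<partial>lborel)"
    using AE_lborel_singleton[of ?a] AE_lborel_singleton[of ?b]
    by (intro nn_integral_cong_AE, eventually_elim) (use out in \<open>force simp: indicator_def\<close>)
  finally have A: "emeasure lborel X = \<dots>" .
  have "emeasure lborel X + (\<integral>\<^sup>+p. ennreal ((kappa X p)\<^sup>2 / 2) \<partial>lborel)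
      + (\<integral>\<^sup>+p. ennreal ((kappa (flip X) p)\<^sup>2 / 2) \<partial>lborel)
    = (\<integral>\<^sup>+s. emeasure lborel {y. vec2 s y \<in> X} * indicator ?J s
        + (\<integral>\<^sup>+p. ennreal (gap_kernel X p s) \<partial>lborel) * indicator ?J s
        + (\<integral>\<^sup>+p. ennreal (gap_kernel (flip X) p s) \<partial>lborel) * indicator ?J s \<partial>lborel)"
    using nn_integral_gap[OF X] nn_integral_gap[OF F]
    by (simp add: nn_integral_add A supp_flip[OF X])
  also have "\<dots> = (\<integral>\<^sup>+s. ennreal ?H * indicator ?J s \<partial>lborel)"
    by (intro nn_integral_cong) (auto simp: indicator_def slice_measure[OF X])
  also have "\<dots> = ennreal ?H * ennreal (?b - ?a)"
    using width_nonneg[OF X, of "vec2 1 0"] by (subst nn_integral_cmult_indicator) auto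
  finally show ?thesis
    using width_nonneg[OF X, of "vec2 1 0"] width_nonneg[OF X, of "vec2 0 1"]
    by (simp add: ennreal_mult mult.commute)
qed

section \<open>Mixed area\<close>

abbreviation area :: "(real^2) set \<Rightarrow> real" where
  "area X \<equiv> measure lebesgue X"

definition width :: "'a::euclidean_space set \<Rightarrow> 'a \<Rightarrow> real" where
  "width X u = supp X u + supp X (- u)"

text \<open>Polarisation of the quadratic formula in \<open>emeasure_convex_body\<close>.
  Bilinearity is inherited from the additivity of \<open>width\<close> and
  \<open>kappa\<close>.\<close>

definition mixed_area :: "(real^2) set \<Rightarrow> (real^2) set \<Rightarrow> real" where
  "mixed_area X Y =
     (width X (vec2 1 0) * width Y (vec2 0 1) + width Y (vec2 1 0) * width X (vec2 0 1)
       - (\<integral>p. kappa X p * kappa Y p \<partial>lborel)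
       - (\<integral>p. kappa (flip X) p * kappa (flip Y) p \<partial>lborel)) / 2"

lemma integrable_kappa_square:
  assumes X: "convex_body X"
  shows "integrable lborel (\<lambda>p. (kappa X p)\<^sup>2)"
proof -
  note [measurable] = X
  have "(\<integral>\<^sup>+p. ennreal ((kappa X p)\<^sup>2 / 2) \<partial>lborel) < \<infinity>"
    using emeasure_convex_body[OF X] by (metis ennreal_add_eq_top ennreal_less_top infinity_ennreal_def less_top)
  then have "integrable lborel (\<lambda>p. (kappa X p)\<^sup>2 / 2)"
    by (intro integrableI_nonneg) auto
  from Bochner_Integration.integrable_mult_right[OF this, of 2] show ?thesis by simp
qed

lemma integrable_kappa_mult:
  assumes X: "convex_body X" and Y: "convex_body Y"
  shows "integrable lborel (\<lambda>p. kappa X p * kappa Y p)"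
proof (rule Bochner_Integration.integrable_bound)
  note [measurable] = X Y
  show "integrable lborel (\<lambda>p. (kappa X p)\<^sup>2 + (kappa Y p)\<^sup>2)"
    using integrable_kappa_square X Y by auto
  show "(\<lambda>p. kappa X p * kappa Y p) \<in> borel_measurable lborel" by measurable
  have "\<bar>x * y\<bar> \<le> x\<^sup>2 + y\<^sup>2" for x y :: real
    using sum_squares_bound[of "\<bar>x\<bar>" "\<bar>y\<bar>"] by (auto simp: abs_mult intro: order_trans[rotated])
  then show "AE p in lborel. norm (kappa X p * kappa Y p) \<le> norm ((kappa X p)\<^sup>2 + (kappa Y p)\<^sup>2)"
    by simp
qed

lemma mixed_area_self:
  assumes X: "convex_body X"
  shows "mixed_area X X = area X"
proof -
  have F: "convex_body (flip X)" using X by (rule convex_body_flip)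
  have *: "(\<integral>\<^sup>+p. ennreal ((kappa Z p)\<^sup>2 / 2) \<partial>lborel) = ennreal ((\<integral>p. (kappa Z p)\<^sup>2 \<partial>lborel) / 2)"
    if "convex_body Z" for Z
    using integrable_kappa_square[OF that] by (subst nn_integral_eq_integral) auto
  have lm: "X \<in> lmeasurable" "X \<in> sets lborel"
    using X by (auto simp: convex_body_def lmeasurable_compact borel_compact)
  then have "emeasure lborel X = ennreal (area X)"
    using emeasure_eq_measure2[of X lebesgue] by (simp add: main_part_sets)
  then have "ennreal (area X + (\<integral>p. (kappa X p)\<^sup>2 \<partial>lborel) / 2 + (\<integral>p. (kappa (flip X) p)\<^sup>2 \<partial>lborel) / 2)
     = ennreal (width X (vec2 1 0) * width X (vec2 0 1))"
    using emeasure_convex_body[OF X] by (simp add: *[OF X] *[OF F] width_def)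
  moreover have "0 \<le> width X u" for u using width_nonneg[OF X] by (simp add: width_def)
  ultimately have "area X + (\<integral>p. (kappa X p)\<^sup>2 \<partial>lborel) / 2 + (\<integral>p. (kappa (flip X) p)\<^sup>2 \<partial>lborel) / 2
     = width X (vec2 1 0) * width X (vec2 0 1)"
    by (subst (asm) ennreal_inj) auto
  then show ?thesis by (simp add: mixed_area_def power2_eq_square field_simps)
qed

lemma mixed_area_commute: "mixed_area X Y = mixed_area Y X"
  by (simp add: mixed_area_def mult.commute)

lemma mixed_area_add_left:
  assumes X: "convex_body X" and Y: "convex_body Y" and Z: "convex_body Z"
  shows "mixed_area (minkowski_sum X Y) Z = mixed_area X Z + mixed_area Y Z"
proof -
  have "(\<integral>p. kappa (minkowski_sum X' Y') p * kappa Z' p \<partial>lborel)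
     = (\<integral>p. kappa X' p * kappa Z' p \<partial>lborel) + (\<integral>p. kappa Y' p * kappa Z' p \<partial>lborel)"
    if "convex_body X'" "convex_body Y'" "convex_body Z'" for X' Y' Z'
    using that by (simp add: kappa_sum distrib_right integrable_kappa_mult)
  then show ?thesis
    using assms
    by (simp add: mixed_area_def flip_sum convex_body_flip width_def supp_sum algebra_simps add_divide_distrib diff_divide_distrib)
qed

lemma mixed_area_add_right:
  assumes "convex_body X" "convex_body Y" "convex_body Z"
  shows "mixed_area Z (minkowski_sum X Y) = mixed_area Z X + mixed_area Z Y"
  using mixed_area_add_left[OF assms] by (simp add: mixed_area_commute)

lemma mixed_area_scale_left:
  assumes "convex_body X" "0 \<le> s"
  shows "mixed_area ((*\<^sub>R) s ` X) Y = s * mixed_area X Y"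
  using assms
  by (simp add: mixed_area_def flip_scale kappa_scale convex_body_flip width_def supp_scale mult.assoc
      algebra_simps diff_divide_distrib)

lemma mixed_area_scale_right:
  assumes "convex_body X" "0 \<le> s"
  shows "mixed_area Y ((*\<^sub>R) s ` X) = s * mixed_area Y X"
  using mixed_area_scale_left[OF assms] by (simp add: mixed_area_commute)

lemma area_sum:
  assumes X: "convex_body X" and Y: "convex_body Y"
  shows "area (minkowski_sum X Y) = area X + 2 * mixed_area X Y + area Y"
proof -
  have "area (minkowski_sum X Y) = mixed_area (minkowski_sum X Y) (minkowski_sum X Y)"
    using assms by (simp add: mixed_area_self convex_body_sum)
  also have "\<dots> = mixed_area X X + mixed_area Y X + (mixed_area X Y + mixed_area Y Y)"
    using assms by (simp only: mixed_area_add_left mixed_area_add_right convex_body_sum)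
  finally show ?thesis
    using assms by (simp add: mixed_area_self mixed_area_commute[of Y X])
qed

text \<open>Recovers mixed areas from areas alone, so translations and linear maps need no
  computation of \<open>kappa\<close>.\<close>

lemma mixed_area_eqI:
  assumes "convex_body X" "convex_body Y"
    and "area (minkowski_sum X Y) = area X + 2 * c + area Y"
  shows "mixed_area X Y = c"
  using area_sum[of X Y] assms by simp

lemma mixed_area_singleton [simp]:
  assumes "convex_body Y"
  shows "mixed_area {b} Y = 0"
proof (rule mixed_area_eqI)
  have "minkowski_sum {b} Y = (+) b ` Y" by (auto simp: minkowski_sum_def)
  then show "area (minkowski_sum {b} Y) = area {b} + 2 * 0 + area Y"
    by (simp add: measure_translation)
qed (use assms in \<open>auto simp: convex_body_singleton\<close>)

lemma mixed_area_translate_left: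
  assumes "convex_body X" "convex_body Y"
  shows "mixed_area ((+) b ` X) Y = mixed_area X Y"
proof -
  have "(+) b ` X = minkowski_sum {b} X" by (auto simp: minkowski_sum_def)
  then show ?thesis using assms by (simp add: mixed_area_add_left convex_body_singleton)
qed

lemma mixed_area_translate_right:
  assumes "convex_body X" "convex_body Y"
  shows "mixed_area Y ((+) b ` X) = mixed_area Y X"
  using mixed_area_translate_left[OF assms] by (simp add: mixed_area_commute)

lemma area_mono:
  assumes "convex_body X" "convex_body Y" "X \<subseteq> Y"
  shows "area X \<le> area Y"
  using assms by (intro measure_mono_fmeasurable)
    (auto simp: convex_body_def lmeasurable_compact fmeasurableD)

text \<open>The area of \<open>s X + Y\<close> is monotone in \<open>X\<close>, and mixed area is
  its first-order coefficient in \<open>s\<close>; the second-order terms disappear as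
  \<open>s\<close> tends to \<open>0\<close>.\<close>

lemma mixed_area_mono_left:
  assumes X: "convex_body X" and X': "convex_body X'" and Y: "convex_body Y" and sub: "X \<subseteq> X'"
  shows "mixed_area X Y \<le> mixed_area X' Y"
proof (rule ccontr)
  assume "\<not> ?thesis"
  then have gap: "0 < mixed_area X Y - mixed_area X' Y" (is "0 < ?g") by simp
  have *: "2 * ?g \<le> s * (area X' - area X)" if "0 < s" for s
  proof -
    have cb: "convex_body ((*\<^sub>R) s ` X)" "convex_body ((*\<^sub>R) s ` X')"
      using X X' by (auto intro: convex_body_scale)
    have ar: "area ((*\<^sub>R) s ` Z) = s * (s * area Z)" if "convex_body Z" for Z
    proof -
      have "area ((*\<^sub>R) s ` Z) = mixed_area ((*\<^sub>R) s ` Z) ((*\<^sub>R) s ` Z)"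
        using that by (simp add: mixed_area_self convex_body_scale)
      then show ?thesis using that \<open>0 < s\<close>
        by (simp add: mixed_area_scale_left mixed_area_scale_right mixed_area_self)
    qed
    have "area (minkowski_sum ((*\<^sub>R) s ` X) Y) \<le> area (minkowski_sum ((*\<^sub>R) s ` X') Y)"
      using sub cb Y by (intro area_mono convex_body_sum minkowski_sum_mono) auto
    then have "0 \<le> s * (s * (area X' - area X) - 2 * ?g)"
      using that cb X X' Y by (simp add: area_sum ar mixed_area_scale_left algebra_simps)
    then show ?thesis using that by (simp add: zero_le_mult_iff)
  qed
  \<comment> \<open>Small enough that the right-hand side of \<open>*\<close> is at most
    \<open>?g\<close>, which is less than \<open>2 * ?g\<close>.\<close>
  define s where "s = ?g / (1 + \<bar>area X' - area X\<bar>)"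
  have "0 < s" using gap by (simp add: s_def)
  have "s * (area X' - area X) \<le> s * (1 + \<bar>area X' - area X\<bar>)"
    using \<open>0 < s\<close> by (intro mult_left_mono) auto
  also have "\<dots> = ?g" by (simp add: s_def)
  finally show False using *[OF \<open>0 < s\<close>] gap by simp
qed

lemma mixed_area_mono_right:
  assumes "convex_body X" "convex_body X'" "convex_body Y" "X \<subseteq> X'"
  shows "mixed_area Y X \<le> mixed_area Y X'"
  using mixed_area_mono_left[OF assms] by (simp add: mixed_area_commute)

lemma mixed_area_linear_image:
  assumes X: "convex_body X" and Y: "convex_body Y" and f: "linear f"
  shows "mixed_area (f ` X) (f ` Y) = \<bar>det (matrix f)\<bar> * mixed_area X Y"
proof (rule mixed_area_eqI)
  have "area (f ` Z) = \<bar>det (matrix f)\<bar> * area Z" if "convex_body Z" for Z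
    using that f by (intro measure_linear_image) (auto simp: convex_body_def lmeasurable_compact)
  then show "area (minkowski_sum (f ` X) (f ` Y))
      = area (f ` X) + 2 * (\<bar>det (matrix f)\<bar> * mixed_area X Y) + area (f ` Y)"
    using assms by (simp add: minkowski_sum_linear_image convex_body_sum area_sum algebra_simps)
qed (use assms in \<open>auto intro: convex_body_linear_image\<close>)

lemma mixed_area_uminus:
  assumes "convex_body X" "convex_body Y"
  shows "mixed_area (uminus ` X) (uminus ` Y) = mixed_area X Y"
proof -
  have "linear (uminus :: real^2 \<Rightarrow> real^2)" by (auto intro: linearI)
  moreover have "det (matrix (uminus :: real^2 \<Rightarrow> real^2)) = 1"
    by (simp add: matrix_def det_2 axis_def)
  ultimately show ?thesis using assms by (simp add: mixed_area_linear_image)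
qed

lemma area_uminus: "convex_body X \<Longrightarrow> area (uminus ` X) = area X"
  using mixed_area_uminus[of X X] by (simp add: mixed_area_self convex_body_uminus)

text \<open>
  Minkowski's inequality for \<open>X\<close> and \<open>- X\<close>: both have the same widths, so only the negative
  definite part of the mixed area sees their difference.
\<close>

lemma area_le_mixed_area_uminus:
  assumes X: "convex_body X"
  shows "area X \<le> mixed_area X (uminus ` X)"
proof -
  let ?Y = "uminus ` X"
  have Y: "convex_body ?Y" using X by (rule convex_body_uminus)
  have w: "width ?Y u = width X u" for u using X by (simp add: width_def supp_uminus)
  have sq: "(\<integral>p. kappa Z p * kappa Z p \<partial>lborel) - 2 * (\<integral>p. kappa Z p * kappa Z' p \<partial>lborel)
      + (\<integral>p. kappa Z' p * kappa Z' p \<partial>lborel) \<ge> 0" if "convex_body Z" "convex_body Z'" for Z Z'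
  proof -
    have "0 \<le> (\<integral>p. (kappa Z p - kappa Z' p)\<^sup>2 \<partial>lborel)" by simp
    also have "\<dots> = (\<integral>p. kappa Z p * kappa Z p - 2 * (kappa Z p * kappa Z' p) + kappa Z' p * kappa Z' p \<partial>lborel)"
      by (intro Bochner_Integration.integral_cong) (auto simp: power2_eq_square algebra_simps)
    also have "\<dots> = (\<integral>p. kappa Z p * kappa Z p \<partial>lborel) - 2 * (\<integral>p. kappa Z p * kappa Z' p \<partial>lborel)
      + (\<integral>p. kappa Z' p * kappa Z' p \<partial>lborel)"
      using that by (simp add: integrable_kappa_mult)
    finally show ?thesis .
  qed
  have "0 \<le> 2 * mixed_area X ?Y - (mixed_area X X + mixed_area ?Y ?Y)"
    using sq[OF X Y] sq[OF convex_body_flip[OF X] convex_body_flip[OF Y]]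
    by (simp add: mixed_area_def w field_simps)
  then show ?thesis using X Y by (simp add: mixed_area_self area_uminus)
qed

section \<open>Mixed area with triangles and segments\<close>

text \<open>Reference shapes with explicit \<open>kappa\<close>; \<open>lin2\<close> followed by a
  translation carries them to arbitrary triangles and segments.\<close>

definition std_triangle :: "(real^2) set" where
  "std_triangle = {x. 0 \<le> x$1 \<and> 0 \<le> x$2 \<and> x$1 + x$2 \<le> 1}"

definition std_segment :: "(real^2) set" where
  "std_segment = {x. 0 \<le> x$1 \<and> x$1 \<le> 1 \<and> x$2 = 0}"

definition lin2 :: "real^2 \<Rightarrow> real^2 \<Rightarrow> real^2 \<Rightarrow> real^2" where
  "lin2 e f z = z$1 *\<^sub>R e + z$2 *\<^sub>R f"

definition cross2 :: "real^2 \<Rightarrow> real^2 \<Rightarrow> real" where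
  "cross2 u v = u$1 * v$2 - u$2 * v$1"

text \<open>For an edge \<open>e\<close> of a positively oriented polygon this is the outer normal
  with the length of the edge, so edge lengths need not appear in later formulas.\<close>

definition edge_normal :: "real^2 \<Rightarrow> real^2" where
  "edge_normal e = vec2 (e$2) (- e$1)"

lemma inner_edge_normal: "x \<bullet> edge_normal e = cross2 x e"
  by (simp add: edge_normal_def cross2_def inner_2)

lemma linear_lin2: "linear (lin2 e f)"
  by (auto intro!: linearI simp: lin2_def algebra_simps)

lemma det_lin2: "det (matrix (lin2 e f)) = cross2 e f"
  by (simp add: matrix_def det_2 lin2_def cross2_def axis_def algebra_simps)

lemma lin2_std_triangle: "(+) p ` lin2 (q - p) (r - p) ` std_triangle = convex hull {p, q, r}"
proof -
  have eq: "lin2 (q - p) (r - p) ` std_triangle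
      = {u *\<^sub>R (q - p) + v *\<^sub>R (r - p) |u v. 0 \<le> u \<and> 0 \<le> v \<and> u + v \<le> 1}"
  proof (intro equalityI subsetI)
    fix x assume "x \<in> {u *\<^sub>R (q - p) + v *\<^sub>R (r - p) |u v. 0 \<le> u \<and> 0 \<le> v \<and> u + v \<le> 1}"
    then obtain u v where "x = u *\<^sub>R (q - p) + v *\<^sub>R (r - p)" "0 \<le> u" "0 \<le> v" "u + v \<le> 1" by blast
    then show "x \<in> lin2 (q - p) (r - p) ` std_triangle"
      by (intro image_eqI[of _ _ "vec2 u v"]) (auto simp: lin2_def std_triangle_def)
  qed (auto simp: lin2_def std_triangle_def)
  show ?thesis unfolding eq convex_hull_3_alt by (fastforce simp: add.assoc)
qed

lemma lin2_std_segment: "(+) p ` lin2 (q - p) f ` std_segment = closed_segment p q"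
proof (intro equalityI subsetI)
  fix x assume "x \<in> closed_segment p q"
  then obtain u where "x = (1 - u) *\<^sub>R p + u *\<^sub>R q" "0 \<le> u" "u \<le> 1" by (auto simp: closed_segment_def)
  then show "x \<in> (+) p ` lin2 (q - p) f ` std_segment"
    unfolding image_image
    by (intro image_eqI[of _ _ "vec2 u 0"]) (auto simp: lin2_def std_segment_def algebra_simps)
next
  fix x assume "x \<in> (+) p ` lin2 (q - p) f ` std_segment"
  then obtain z where "z \<in> std_segment" "x = p + lin2 (q - p) f z" by blast
  then have "x = p + z$1 *\<^sub>R (q - p)" "0 \<le> z$1" "z$1 \<le> 1"
    by (simp_all add: lin2_def std_segment_def)
  then show "x \<in> closed_segment p q" by (auto simp: closed_segment_def algebra_simps)
qed

lemma convex_body_hull: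
  assumes "finite S" "S \<noteq> {}"
  shows "convex_body (convex hull S)"
  using assms by (auto simp: convex_body_def finite_imp_compact_convex_hull)

lemma convex_body_segment: "convex_body (closed_segment p q)"
  by (simp add: convex_body_def)

lemma std_triangle_hull: "std_triangle = convex hull {0, vec2 1 0, vec2 0 1}"
proof -
  have "lin2 (vec2 1 0) (vec2 0 1) = (\<lambda>z. z)" by (auto simp: lin2_def vec_eq_2)
  then show ?thesis using lin2_std_triangle[of 0 "vec2 1 0" "vec2 0 1"] by simp
qed

lemma std_segment_eq: "std_segment = closed_segment 0 (vec2 1 0)"
proof -
  have "lin2 (vec2 1 0) (vec2 0 1) = (\<lambda>z. z)" by (auto simp: lin2_def vec_eq_2)
  then show ?thesis using lin2_std_segment[of 0 "vec2 1 0" "vec2 0 1"] by simp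
qed

lemma convex_body_std: "convex_body std_triangle" "convex_body std_segment"
  by (simp_all add: std_triangle_hull std_segment_eq convex_body_hull convex_body_segment)

section \<open>Contact points of the reference shapes\<close>

lemma ext_eqI:
  assumes "vec2 s y \<in> X"
    and "\<And>x. x \<in> X \<Longrightarrow> p * x$1 + x$2 \<le> p * s + y"
    and "\<And>x. x \<in> X \<Longrightarrow> p * x$1 + x$2 = p * s + y \<Longrightarrow> x$1 \<le> s"
  shows "ext X p = s"
proof -
  have "supp X (vec2 p 1) = p * s + y"
    using assms(1,2) by (intro supp_eqI[of "vec2 s y"]) (auto simp: inner_2 algebra_simps)
  then show ?thesis
    unfolding ext_def using assms(1,3)
    by (intro supp_eqI[of "vec2 s y"]) (auto simp: mem_face inner_2 algebra_simps)
qed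

lemma supp_std_triangle:
  "supp std_triangle (vec2 1 0) = 1" "supp std_triangle (vec2 (-1) 0) = 0"
  "supp std_triangle (vec2 0 1) = 1" "supp std_triangle (vec2 0 (-1)) = 0"
  by (rule supp_eqI[of "vec2 1 0"] supp_eqI[of 0] supp_eqI[of "vec2 0 1"],
      auto simp: std_triangle_def inner_2)+

lemma supp_std_segment:
  "supp std_segment (vec2 1 0) = 1" "supp std_segment (vec2 (-1) 0) = 0"
  "supp std_segment (vec2 0 1) = 0" "supp std_segment (vec2 0 (-1)) = 0"
  by (rule supp_eqI[of "vec2 1 0"] supp_eqI[of 0],
      auto simp: std_segment_def inner_2)+

lemma mem_flip: "x \<in> flip X \<longleftrightarrow> vec2 (x$1) (- x$2) \<in> X"
  using vec2_mem_flip[of "x$1" "x$2" X] by simp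

text \<open>The contact point jumps from \<open>(0, 1)\<close> to \<open>(1, 0)\<close> at
  \<open>p = 1\<close>, where the line lies along the hypotenuse and the rightmost point
  counts.\<close>

lemma kappa_std_triangle: "kappa std_triangle p = indicator {0..<1} p"
proof (cases "p < 1")
  case True
  have "ext std_triangle p = 0"
  proof (rule ext_eqI[of 0 1])
    fix x assume "x \<in> std_triangle"
    then have x: "0 \<le> x$1" "x$1 + x$2 \<le> 1" by (auto simp: std_triangle_def)
    then have *: "0 \<le> (1 - p) * x$1" using True by simp
    show "p * x$1 + x$2 \<le> p * 0 + 1" using x * by (simp add: algebra_simps)
    assume "p * x$1 + x$2 = p * 0 + 1"
    then have "(1 - p) * x$1 \<le> 0" using x by (simp add: algebra_simps)
    then show "x$1 \<le> 0" using True by (simp add: mult_le_0_iff)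
  qed (simp add: std_triangle_def)
  then show ?thesis using True by (simp add: kappa_def supp_std_triangle)
next
  case False
  have "ext std_triangle p = 1"
  proof (rule ext_eqI[of 1 0])
    fix x assume "x \<in> std_triangle"
    then have x: "0 \<le> x$2" "x$1 + x$2 \<le> 1" by (auto simp: std_triangle_def)
    then have "p * (x$1 + x$2) \<le> p" "0 \<le> (p - 1) * x$2"
      using False by (simp_all add: mult_left_le)
    then show "p * x$1 + x$2 \<le> p * 1 + 0" by (simp add: algebra_simps)
    show "x$1 \<le> 1" using x by simp
  qed (simp add: std_triangle_def)
  then show ?thesis using False by (simp add: kappa_def supp_std_triangle)
qed

text \<open>The lower boundary is the bottom side of the bounding box, so there is no gap
  below.\<close>

lemma kappa_flip_std_triangle: "kappa (flip std_triangle) p = 0"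
proof (cases "p < 0")
  case True
  have "ext (flip std_triangle) p = 0"
  proof (rule ext_eqI[of 0 0])
    fix x assume "x \<in> flip std_triangle"
    then have x: "0 \<le> x$1" "x$2 \<le> 0" by (auto simp: std_triangle_def mem_flip)
    then have *: "p * x$1 \<le> 0" using True by (simp add: mult_le_0_iff)
    show "p * x$1 + x$2 \<le> p * 0 + 0" using x * by simp
    assume "p * x$1 + x$2 = p * 0 + 0"
    then have "p * x$1 = 0" using x * by linarith
    then show "x$1 \<le> 0" using True by simp
  qed (simp add: std_triangle_def mem_flip)
  then show ?thesis using True
    by (simp add: kappa_def supp_flip[OF convex_body_std(1)] supp_std_triangle)
next
  case False
  have "ext (flip std_triangle) p = 1"
  proof (rule ext_eqI[of 1 0])
    fix x assume "x \<in> flip std_triangle"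
    then have x: "x$2 \<le> 0" "x$1 - x$2 \<le> 1" by (auto simp: std_triangle_def mem_flip)
    then have "p * x$1 \<le> p" using False by (intro mult_left_le) auto
    then show "p * x$1 + x$2 \<le> p * 1 + 0" using x by simp
    show "x$1 \<le> 1" using x by simp
  qed (simp add: std_triangle_def mem_flip)
  then show ?thesis using False
    by (simp add: kappa_def supp_flip[OF convex_body_std(1)] supp_std_triangle)
qed

lemma flip_std_segment: "flip std_segment = std_segment"
  by (auto simp: mem_flip std_segment_def)

lemma kappa_std_segment: "kappa std_segment p = 0"
proof (cases "p < 0")
  case True
  have "ext std_segment p = 0"
  proof (rule ext_eqI[of 0 0])
    fix x assume "x \<in> std_segment"
    then have x: "0 \<le> x$1" "x$2 = 0" by (auto simp: std_segment_def)
    show "p * x$1 + x$2 \<le> p * 0 + 0" using x True by (simp add: mult_le_0_iff)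
    show "x$1 \<le> 0" if "p * x$1 + x$2 = p * 0 + 0" using that x True by simp
  qed (simp add: std_segment_def)
  then show ?thesis using True by (simp add: kappa_def supp_std_segment)
next
  case False
  have "ext std_segment p = 1"
  proof (rule ext_eqI[of 1 0])
    fix x assume "x \<in> std_segment"
    then have x: "x$1 \<le> 1" "x$2 = 0" by (auto simp: std_segment_def)
    then show "p * x$1 + x$2 \<le> p * 1 + 0" using False by (simp add: mult_left_le)
    show "x$1 \<le> 1" using x by simp
  qed (simp add: std_segment_def)
  then show ?thesis using False by (simp add: kappa_def supp_std_segment)
qed

lemma mixed_area_std_segment:
  "mixed_area std_segment X = width X (vec2 0 1) / 2"
  by (simp add: mixed_area_def flip_std_segment kappa_std_segment width_def supp_std_segment)

text \<open>\<open>kappa\<close> of the triangle cuts the integral down to the unit interval, where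
  the integral of \<open>ext X\<close> telescopes to support values; the axis terms cancel against
  the widths.\<close>

lemma mixed_area_std_triangle:
  assumes X: "convex_body X"
  shows "mixed_area std_triangle X
    = (supp X (vec2 (-1) 0) + supp X (vec2 0 (-1)) + supp X (vec2 1 1)) / 2"
proof -
  let ?f = "\<lambda>p. kappa std_triangle p * kappa X p"
  have "(?f has_integral (\<integral>p. ?f p \<partial>lborel)) UNIV"
    using integrable_kappa_mult[OF convex_body_std(1) X] by (rule has_integral_integral_lborel)
  then have "((\<lambda>p. if p \<in> {0..1} then ?f p else 0) has_integral (\<integral>p. ?f p \<partial>lborel)) UNIV"
    by (rule has_integral_eq[rotated]) (auto simp: kappa_std_triangle)
  then have A: "(?f has_integral (\<integral>p. ?f p \<partial>lborel)) {0..1}"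
    by (simp only: has_integral_restrict_UNIV)
  have "((\<lambda>p. supp X (vec2 1 0) - ext X p) has_integral
      (1 - 0) * supp X (vec2 1 0) - (supp X (vec2 1 1) - supp X (vec2 0 1))) {0..1}"
    using has_integral_const_real[of "supp X (vec2 1 0)" 0 1]
    by (intro has_integral_diff ext_has_integral[OF X]) auto
  \<comment> \<open>The integrands differ only at \<open>1\<close>, where
    \<open>kappa std_triangle\<close> is already \<open>0\<close>.\<close>
  then have B: "(?f has_integral
      (1 - 0) * supp X (vec2 1 0) - (supp X (vec2 1 1) - supp X (vec2 0 1))) {0..1}"
    by (rule has_integral_spike_finite[of "{1}", rotated 2])
      (auto simp: kappa_std_triangle kappa_def[of X])
  have "(\<integral>p. ?f p \<partial>lborel) = supp X (vec2 1 0) - supp X (vec2 1 1) + supp X (vec2 0 1)"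
    using has_integral_unique[OF A B] by simp
  then show ?thesis
    by (simp add: mixed_area_def kappa_flip_std_triangle width_def supp_std_triangle)
qed

lemma supp_image:
  assumes "convex_body X" "linear g" "0 \<le> c" "\<And>x. g x \<bullet> u = c * (x \<bullet> v)"
  shows "supp (g ` X) u = c * supp X v"
proof -
  obtain x where "x \<in> X" "x \<bullet> v = supp X v"
    using supp_attained assms(1) unfolding convex_body_def by metis
  then show ?thesis
    using assms supp_ge[of X _ v]
    by (intro supp_eqI[of "g x"]) (auto simp: convex_body_def intro!: mult_left_mono)
qed

text \<open>Cramer's rule. The last property translates directions for the pulled-back body into
  edge normals for the original one.\<close>

lemma lin2_inverse:
  assumes d: "0 < cross2 e f"
  obtains g where "linear g" "\<And>X. lin2 e f ` g ` X = X"
    and "\<And>x a b. g x \<bullet> vec2 a b = (1 / cross2 e f) * (x \<bullet> edge_normal (a *\<^sub>R f - b *\<^sub>R e))"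
proof
  define g where "g x = (1 / cross2 e f) *\<^sub>R vec2 (cross2 x f) (cross2 e x)" for x
  show "linear g"
    by (auto intro!: linearI simp: g_def vec_eq_2 cross2_def algebra_simps add_divide_distrib diff_divide_distrib)
  have "lin2 e f (g x) = x" for x
  proof -
    have "cross2 x f * e$1 + cross2 e x * f$1 = cross2 e f * x$1"
      "cross2 x f * e$2 + cross2 e x * f$2 = cross2 e f * x$2"
      by (simp_all add: cross2_def algebra_simps)
    then show ?thesis
      using d by (simp add: lin2_def g_def vec_eq_2 add_divide_distrib[symmetric])
  qed
  then show "lin2 e f ` g ` X = X" for X by (simp add: image_image)
  show "g x \<bullet> vec2 a b = (1 / cross2 e f) * (x \<bullet> edge_normal (a *\<^sub>R f - b *\<^sub>R e))" for x a b
    by (simp add: g_def inner_2 edge_normal_def cross2_def algebra_simps add_divide_distrib diff_divide_distrib)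
qed

text \<open>Pull \<open>X\<close> back to the reference triangle; the determinant gained by the
  mixed area cancels the one in the support values.\<close>

lemma mixed_area_triangle:
  assumes X: "convex_body X" and d: "0 < cross2 (q - p) (r - p)"
  shows "mixed_area (convex hull {p, q, r}) X
    = (supp X (edge_normal (q - p)) + supp X (edge_normal (r - q)) + supp X (edge_normal (p - r))) / 2"
proof -
  let ?L = "lin2 (q - p) (r - p)"
  let ?d = "cross2 (q - p) (r - p)"
  obtain g where g: "linear g" "\<And>X. ?L ` g ` X = X"
    and gi: "\<And>x a b. g x \<bullet> vec2 a b = (1 / ?d) * (x \<bullet> edge_normal (a *\<^sub>R (r - p) - b *\<^sub>R (q - p)))"
    using lin2_inverse[OF d] by blast
  have gX: "convex_body (g ` X)" using X g(1) by (rule convex_body_linear_image)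
  have supp: "supp (g ` X) (vec2 a b) = supp X (edge_normal (a *\<^sub>R (r - p) - b *\<^sub>R (q - p))) / ?d" for a b
    using supp_image[OF X g(1) _ gi] d by simp
  have "mixed_area (convex hull {p, q, r}) X = mixed_area (?L ` std_triangle) X"
    unfolding lin2_std_triangle[symmetric]
    by (intro mixed_area_translate_left convex_body_linear_image convex_body_std linear_lin2 X)
  also have "\<dots> = mixed_area (?L ` std_triangle) (?L ` g ` X)" by (simp add: g(2))
  also have "\<dots> = ?d * mixed_area std_triangle (g ` X)"
    using d by (simp add: mixed_area_linear_image convex_body_std gX linear_lin2 det_lin2)
  also have "\<dots> = (supp X (edge_normal (q - p)) + supp X (edge_normal (r - q)) + supp X (edge_normal (p - r))) / 2"
    using d by (simp add: mixed_area_std_triangle[OF gX] supp field_simps)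
  finally show ?thesis .
qed

lemma mixed_area_segment:
  assumes X: "convex_body X"
  shows "mixed_area (closed_segment p q) X = width X (edge_normal (q - p)) / 2"
proof (cases "p = q")
  case True
  have "edge_normal 0 = 0" by (simp add: edge_normal_def vec_eq_2)
  moreover have "supp X 0 = 0" using X by (auto simp: convex_body_def intro!: supp_eqI)
  ultimately show ?thesis using True X by (simp add: width_def)
next
  case False
  \<comment> \<open>The second basis vector is the edge turned by a right angle, so the determinant
    is the squared edge length.\<close>
  let ?e = "q - p" and ?f = "- edge_normal (q - p)"
  have "?e$1 \<noteq> 0 \<or> ?e$2 \<noteq> 0" using False by (auto simp: vec_eq_2)
  moreover have "cross2 ?e ?f = (?e$1)\<^sup>2 + (?e$2)\<^sup>2"
    by (simp add: cross2_def edge_normal_def power2_eq_square algebra_simps)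
  ultimately have d: "0 < cross2 ?e ?f"
    by (simp only: sum_power2_gt_zero_iff)
  obtain g where g: "linear g" "\<And>X. lin2 ?e ?f ` g ` X = X"
    and gi: "\<And>x a b. g x \<bullet> vec2 a b = (1 / cross2 ?e ?f) * (x \<bullet> edge_normal (a *\<^sub>R ?f - b *\<^sub>R ?e))"
    using lin2_inverse[OF d] by blast
  have gX: "convex_body (g ` X)" using X g(1) by (rule convex_body_linear_image)
  have supp: "supp (g ` X) (vec2 a b) = supp X (edge_normal (a *\<^sub>R ?f - b *\<^sub>R ?e)) / cross2 ?e ?f" for a b
    using supp_image[OF X g(1) _ gi] d by simp
  have "mixed_area (closed_segment p q) X = mixed_area (lin2 ?e ?f ` std_segment) X"
    unfolding lin2_std_segment[where f = ?f, symmetric]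
    by (intro mixed_area_translate_left convex_body_linear_image convex_body_std linear_lin2 X)
  also have "\<dots> = mixed_area (lin2 ?e ?f ` std_segment) (lin2 ?e ?f ` g ` X)" by (simp add: g(2))
  also have "\<dots> = cross2 ?e ?f * mixed_area std_segment (g ` X)"
    using d by (simp add: mixed_area_linear_image convex_body_std gX linear_lin2 det_lin2)
  also have "\<dots> = width X (edge_normal ?e) / 2"
  proof -
    have "- edge_normal ?e = edge_normal (p - q)" by (simp add: edge_normal_def vec_eq_2)
    then show ?thesis
      using d by (simp add: mixed_area_std_segment width_def supp field_simps)
  qed
  finally show ?thesis .
qed

section \<open>The Rogers-Shephard inequality in the plane\<close>

text \<open>Twice the signed area of the triangle.\<close>

definition orient :: "real^2 \<Rightarrow> real^2 \<Rightarrow> real^2 \<Rightarrow> real" where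
  "orient p q r = cross2 (q - p) (r - p)"

lemma orient_cycle: "orient p q r = orient q r p"
  by (simp add: orient_def cross2_def algebra_simps)

lemma orient_swap: "orient p r q = - orient p q r"
  by (simp add: orient_def cross2_def algebra_simps)

lemma orient_edge: "orient x q r = cross2 q (r - q) - cross2 x (r - q)"
  by (simp add: orient_def cross2_def algebra_simps)

lemma orient_sum: "orient x q r + orient p x r + orient p q x = orient p q r"
  by (simp add: orient_def cross2_def algebra_simps)

lemma barycentric:
  "orient p q r *\<^sub>R x = orient x q r *\<^sub>R p + orient p x r *\<^sub>R q + orient p q x *\<^sub>R r"
  by (simp add: vec_eq_2 orient_def cross2_def algebra_simps)

lemma barycentric':
  assumes "orient p q r \<noteq> 0"
  shows "x = (orient x q r / orient p q r) *\<^sub>R p + (orient p x r / orient p q r) *\<^sub>R q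
    + (orient p q x / orient p q r) *\<^sub>R r"
proof -
  have "x = (1 / orient p q r) *\<^sub>R (orient p q r *\<^sub>R x)" using assms by simp
  also have "\<dots> = (orient x q r / orient p q r) *\<^sub>R p + (orient p x r / orient p q r) *\<^sub>R q
    + (orient p q x / orient p q r) *\<^sub>R r"
    unfolding barycentric[of p q r x] by (simp add: scaleR_add_right)
  finally show ?thesis .
qed

lemma hull_3_scaleI:
  assumes "0 < t" "0 \<le> u" "0 \<le> v" "0 \<le> w" "u + v + w = t"
  shows "u *\<^sub>R p + v *\<^sub>R q + w *\<^sub>R r \<in> (*\<^sub>R) t ` (convex hull {p, q, r})"
proof
  show "u *\<^sub>R p + v *\<^sub>R q + w *\<^sub>R r = t *\<^sub>R ((u/t) *\<^sub>R p + (v/t) *\<^sub>R q + (w/t) *\<^sub>R r)"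
    using assms by (simp add: scaleR_add_right)
  show "(u/t) *\<^sub>R p + (v/t) *\<^sub>R q + (w/t) *\<^sub>R r \<in> convex hull {p, q, r}"
  proof -
    have "0 \<le> u/t" "0 \<le> v/t" "0 \<le> w/t" "u/t + v/t + w/t = 1"
      using assms by (simp_all add: add_divide_distrib[symmetric])
    then show ?thesis unfolding convex_hull_3 by blast
  qed
qed

lemma supp_hull_3:
  "supp (convex hull {p, q, r}) u = max (p \<bullet> u) (max (q \<bullet> u) (r \<bullet> u))"
proof -
  let ?m = "max (p \<bullet> u) (max (q \<bullet> u) (r \<bullet> u))"
  have "convex hull {p, q, r} \<subseteq> {x. u \<bullet> x \<le> ?m}"
    by (intro hull_minimal convex_halfspace_le) (auto simp: inner_commute)
  then have "x \<bullet> u \<le> ?m" if "x \<in> convex hull {p, q, r}" for x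
    using that by (auto simp: inner_commute)
  moreover have "p \<in> convex hull {p, q, r}" "q \<in> convex hull {p, q, r}" "r \<in> convex hull {p, q, r}"
    by (auto intro: hull_inc)
  moreover have "?m = p \<bullet> u \<or> ?m = q \<bullet> u \<or> ?m = r \<bullet> u" by (auto simp: max_def)
  ultimately show ?thesis using supp_eqI by metis
qed

text \<open>Mixed area of the triangle with itself, where each edge normal is maximised on its own
  edge.\<close>

lemma area_triangle:
  assumes "0 < orient p q r"
  shows "area (convex hull {p, q, r}) = orient p q r / 2"
proof -
  have e: "cross2 q (q - p) = cross2 p (q - p)" "cross2 r (q - p) \<le> cross2 p (q - p)"
    "cross2 r (r - q) = cross2 q (r - q)" "cross2 p (r - q) \<le> cross2 q (r - q)"
    "cross2 p (p - r) = cross2 r (p - r)" "cross2 q (p - r) \<le> cross2 r (p - r)"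
    using assms by (simp_all add: orient_def cross2_def algebra_simps)
  have "area (convex hull {p, q, r}) = mixed_area (convex hull {p, q, r}) (convex hull {p, q, r})"
    by (simp add: mixed_area_self convex_body_hull)
  also have "\<dots> = (cross2 p (q - p) + cross2 q (r - q) + cross2 r (p - r)) / 2"
    using assms e by (subst mixed_area_triangle)
      (simp_all add: convex_body_hull orient_def supp_hull_3 inner_edge_normal max_def)
  also have "\<dots> = orient p q r / 2" by (simp add: orient_def cross2_def algebra_simps)
  finally show ?thesis .
qed

lemma cross2_eq_0_imp_multiple:
  assumes "cross2 e v = 0" "e \<noteq> 0"
  shows "\<exists>c. v = c *\<^sub>R e"
proof (cases "e$1 = 0")
  case True
  with assms have "e$2 \<noteq> 0" "v$1 = 0" by (auto simp: vec_eq_2 cross2_def)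
  with True show ?thesis by (intro exI[of _ "v$2 / e$2"]) (simp add: vec_eq_2)
next
  case False
  then show ?thesis using assms
    by (intro exI[of _ "v$1 / e$1"]) (simp add: vec_eq_2 cross2_def field_simps)
qed

lemma collinear_if_orient_0:
  assumes "\<And>x y z. x \<in> A \<Longrightarrow> y \<in> A \<Longrightarrow> z \<in> A \<Longrightarrow> orient x y z = 0"
  shows "collinear A"
proof (cases "\<exists>p q. p \<in> A \<and> q \<in> A \<and> p \<noteq> q")
  case True
  then obtain p q where pq: "p \<in> A" "q \<in> A" "p \<noteq> q" by blast
  have "\<exists>c. x - y = c *\<^sub>R (q - p)" if "x \<in> A" "y \<in> A" for x y
  proof (rule cross2_eq_0_imp_multiple)
    have "cross2 (q - p) (x - y) = orient p q x - orient p q y"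
      by (simp add: orient_def cross2_def algebra_simps)
    then show "cross2 (q - p) (x - y) = 0" using assms pq that by simp
  qed (use pq in simp)
  then show ?thesis unfolding collinear_def by blast
next
  case False
  then show ?thesis unfolding collinear_def by (metis diff_self scaleR_zero_left)
qed

lemma area_0_imp_segment:
  assumes A: "convex_body A" and "area A = 0"
  obtains p q where "A = closed_segment p q"
proof -
  have le: "orient x y z \<le> 0" if "x \<in> A" "y \<in> A" "z \<in> A" for x y z
  proof (rule ccontr)
    assume "\<not> ?thesis"
    then have pos: "0 < orient x y z" by simp
    have "convex hull {x, y, z} \<subseteq> A"
      using that A by (intro hull_minimal) (auto simp: convex_body_def)
    then have "area (convex hull {x, y, z}) \<le> area A"
      using A by (intro area_mono convex_body_hull) auto
    with pos show False using assms(2) by (simp add: area_triangle)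
  qed
  have "orient x y z = 0" if "x \<in> A" "y \<in> A" "z \<in> A" for x y z
    using le[of x y z] le[of x z y] that orient_swap[of x z y] by simp
  then have "collinear A" by (rule collinear_if_orient_0)
  then show ?thesis
    using A compact_convex_collinear_segment_alt[of A] that
    by (auto simp: convex_body_def convex_connected)
qed

lemma area_segment: "area (closed_segment p q) = 0"
proof -
  have "supp (closed_segment p q) u = max (p \<bullet> u) (q \<bullet> u)" for u
    using supp_hull_3[of p q q u] by (simp add: segment_convex_hull)
  moreover have "p \<bullet> edge_normal (q - p) = q \<bullet> edge_normal (q - p)"
    by (simp add: inner_edge_normal cross2_def algebra_simps)
  ultimately have "mixed_area (closed_segment p q) (closed_segment p q) = 0"
    by (simp add: mixed_area_segment convex_body_segment width_def)
  then show ?thesis by (simp add: mixed_area_self convex_body_segment)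
qed

section \<open>Inscribed triangles of largest area\<close>

text \<open>Maximising the signed area also bounds the unsigned one, since swapping two points flips
  the sign.\<close>

locale largest_triangle =
  fixes A :: "(real^2) set" and p q r :: "real^2"
  assumes A: "convex_body A" and vertices: "p \<in> A" "q \<in> A" "r \<in> A"
    and pos: "0 < orient p q r"
    and largest: "\<And>x y z. x \<in> A \<Longrightarrow> y \<in> A \<Longrightarrow> z \<in> A \<Longrightarrow> orient x y z \<le> orient p q r"
begin

text \<open>Carries statements about one vertex over to the other two.\<close>

lemma rotate: "largest_triangle A q r p"
  using A vertices pos largest by unfold_locales (simp_all add: orient_cycle[of p q r])

lemma hull_subset: "convex hull {p, q, r} \<subseteq> A"
  using A vertices by (intro hull_minimal) (auto simp: convex_body_def)

text \<open>The weights are \<open>1\<close> minus the barycentric coordinates of \<open>x\<close>, hence nonnegative by maximality.\<close>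

lemma reflected_coordinates:
  assumes "x \<in> A"
  obtains u v w where "p + q + r - x = u *\<^sub>R p + v *\<^sub>R q + w *\<^sub>R r"
    "0 \<le> u" "0 \<le> v" "0 \<le> w" "u + v + w = 2" "v = 1 - orient p x r / orient p q r"
proof
  let ?d = "orient p q r"
  let ?u = "1 - orient x q r / ?d" and ?v = "1 - orient p x r / ?d" and ?w = "1 - orient p q x / ?d"
  have x: "x = (orient x q r / ?d) *\<^sub>R p + (orient p x r / ?d) *\<^sub>R q + (orient p q x / ?d) *\<^sub>R r"
    using pos by (intro barycentric') simp
  show "p + q + r - x = ?u *\<^sub>R p + ?v *\<^sub>R q + ?w *\<^sub>R r"
    by (subst x) (simp add: scaleR_diff_left)
  show "0 \<le> ?u" "0 \<le> ?v" "0 \<le> ?w"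
    using largest assms vertices pos by (simp_all add: field_simps)
  have "(orient x q r + orient p x r + orient p q x) / ?d = 1"
    using pos by (simp add: orient_sum)
  then show "?u + ?v + ?w = 2" by (simp add: add_divide_distrib)
qed simp

text \<open>Reflecting \<open>A\<close> in a point is a translate of \<open>- A\<close>, so any
  container \<open>L\<close> of the reflection gives a bound. It serves for twice the triangle and
  for its truncation.\<close>

lemma mixed_area_uminus_le:
  assumes L: "convex_body L" and sub: "\<And>x. x \<in> A \<Longrightarrow> p + q + r - x \<in> L"
  shows "mixed_area A (uminus ` A) \<le> mixed_area A L"
proof -
  have "(+) (p + q + r) ` uminus ` A \<subseteq> L" using sub by auto
  moreover have cb: "convex_body ((+) (p + q + r) ` uminus ` A)"
  proof -
    have "(+) (p + q + r) ` uminus ` A = minkowski_sum {p + q + r} (uminus ` A)"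
      by (auto simp: minkowski_sum_def)
    then show ?thesis
      using A by (simp add: convex_body_sum convex_body_singleton convex_body_uminus)
  qed
  ultimately have "mixed_area A ((+) (p + q + r) ` uminus ` A) \<le> mixed_area A L"
    using A L by (intro mixed_area_mono_right)
  then show ?thesis using A by (simp add: mixed_area_translate_right convex_body_uminus)
qed

lemma mixed_area_le_area: "mixed_area A (convex hull {p, q, r}) \<le> area A"
  using mixed_area_mono_right[OF _ A A hull_subset] A by (simp add: convex_body_hull mixed_area_self)

lemma rogers_shephard: "mixed_area A (uminus ` A) \<le> 2 * area A"
proof -
  have "p + q + r - x \<in> (*\<^sub>R) 2 ` (convex hull {p, q, r})" if "x \<in> A" for x
    using reflected_coordinates[OF that] hull_3_scaleI by (metis zero_less_numeral)
  then have "mixed_area A (uminus ` A) \<le> mixed_area A ((*\<^sub>R) 2 ` (convex hull {p, q, r}))"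
    by (intro mixed_area_uminus_le convex_body_scale convex_body_hull) auto
  then show ?thesis
    using mixed_area_le_area by (simp add: mixed_area_scale_right convex_body_hull)
qed

text \<open>
  If the vertex \<open>p + r - q\<close> of the anticomplementary triangle is missing from \<open>A\<close>, then the reflection of
  \<open>A\<close> fits into twice the triangle with a corner cut off, i.e. into the sum of a smaller homothetic
  triangle and a segment. Under equality this forces the corner at \<open>q\<close> of the homothetic
  triangle circumscribed about \<open>A\<close> to lie in \<open>A\<close>.
\<close>

lemma circumscribed_corner:
  assumes eq: "mixed_area A (uminus ` A) = 2 * area A" and out: "p + r - q \<notin> A"
  obtains w where "w \<in> A" "w \<bullet> edge_normal (q - p) = supp A (edge_normal (q - p))"
    "w \<bullet> edge_normal (r - q) = supp A (edge_normal (r - q))"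
proof -
  let ?d = "orient p q r" and ?T = "convex hull {p, q, r}" and ?I = "closed_segment p r"
  let ?g = "\<lambda>x. 1 - orient p x r / ?d"
  have "continuous_on A ?g"
    unfolding orient_def cross2_def by (intro continuous_intros) (use pos in \<open>simp add: orient_def cross2_def\<close>)
  then obtain x0 where x0: "x0 \<in> A" "\<And>x. x \<in> A \<Longrightarrow> ?g x \<le> ?g x0"
    using continuous_attains_sup[of A ?g] A by (auto simp: convex_body_def)
  \<comment> \<open>Largest weight at \<open>q\<close> among the reflected points: it says how close
    the reflection of \<open>A\<close> comes to the corner \<open>2 q\<close>.\<close>
  define M where "M = ?g x0"
  have "orient p p r = 0" by (simp add: orient_def cross2_def)
  then have M1: "1 \<le> M" using x0(2)[OF vertices(1)] by (simp add: M_def)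
  \<comment> \<open>Weight \<open>2\<close> would put a reflected point at \<open>2 q\<close>, that
    is, put \<open>p + r - q\<close> into \<open>A\<close>.\<close>
  have M2: "M < 2"
  proof (rule ccontr)
    assume "\<not> ?thesis"
    obtain u v w where c: "p + q + r - x0 = u *\<^sub>R p + v *\<^sub>R q + w *\<^sub>R r"
      "0 \<le> u" "0 \<le> v" "0 \<le> w" "u + v + w = 2" "v = M"
      using reflected_coordinates[OF x0(1)] unfolding M_def by metis
    with \<open>\<not> ?thesis\<close> have "u = 0" "w = 0" "v = 2" by auto
    with c(1) have "p + q + r - x0 = q + q" by (simp add: scaleR_2)
    then have "x0 = p + r - q" by (simp add: algebra_simps)
    with x0(1) out show False by simp
  qed
  define \<delta> where "\<delta> = 2 - M"
  have \<delta>: "0 < \<delta>" using M2 by (simp add: \<delta>_def)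
  let ?L = "minkowski_sum ((*\<^sub>R) M ` ?T) ((*\<^sub>R) \<delta> ` ?I)"
  have "p + q + r - x \<in> ?L" if x: "x \<in> A" for x
  proof -
    obtain u v w where c: "p + q + r - x = u *\<^sub>R p + v *\<^sub>R q + w *\<^sub>R r"
      "0 \<le> u" "0 \<le> v" "0 \<le> w" "u + v + w = 2" "v \<le> M"
      using reflected_coordinates[OF x] x0(2)[OF x] unfolding M_def by metis
    \<comment> \<open>\<open>m\<close> is the weight on \<open>p\<close> and \<open>r\<close>. The
      fraction \<open>k\<close> of it goes to the segment, with total \<open>\<delta>\<close>; the
      remaining weights then sum to \<open>M\<close>.\<close>
    define m where "m = u + w"
    have m: "\<delta> \<le> m" "0 < m" using c M2 by (auto simp: m_def \<delta>_def)
    define k where "k = \<delta> / m"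
    have k: "0 \<le> k" "k \<le> 1" "k * m = \<delta>" using m \<delta> by (auto simp: k_def)
    have "(u * (1 - k)) *\<^sub>R p + v *\<^sub>R q + (w * (1 - k)) *\<^sub>R r \<in> (*\<^sub>R) M ` ?T"
    proof (rule hull_3_scaleI)
      have "u * (1 - k) + v + w * (1 - k) = u + v + w - k * m" by (simp add: m_def algebra_simps)
      then show "u * (1 - k) + v + w * (1 - k) = M" using c k by (simp add: \<delta>_def)
    qed (use c k M1 in auto)
    moreover have "\<delta> *\<^sub>R ((u / m) *\<^sub>R p + (w / m) *\<^sub>R r) \<in> (*\<^sub>R) \<delta> ` ?I"
    proof (rule imageI)
      have "u / m = 1 - w / m" using m by (simp add: m_def field_simps)
      then show "(u / m) *\<^sub>R p + (w / m) *\<^sub>R r \<in> ?I"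
        using c m by (auto simp: closed_segment_def m_def intro!: exI[of _ "w / m"])
    qed
    moreover have "p + q + r - x = ((u * (1 - k)) *\<^sub>R p + v *\<^sub>R q + (w * (1 - k)) *\<^sub>R r)
        + \<delta> *\<^sub>R ((u / m) *\<^sub>R p + (w / m) *\<^sub>R r)"
      unfolding c(1) by (simp add: k_def algebra_simps)
    ultimately show ?thesis unfolding minkowski_sum_def by blast
  qed
  then have "mixed_area A (uminus ` A) \<le> mixed_area A ?L"
    by (intro mixed_area_uminus_le convex_body_sum convex_body_scale convex_body_hull convex_body_segment) auto
  also have "\<dots> = M * mixed_area A ?T + \<delta> * mixed_area A ?I"
    using M1 \<delta> A by (simp add: mixed_area_add_right mixed_area_scale_right convex_body_hull
        convex_body_segment convex_body_scale)
  finally have "\<delta> * mixed_area A ?T \<le> \<delta> * mixed_area A ?I"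
    using eq mixed_area_le_area by (simp add: \<delta>_def algebra_simps)
  then have "mixed_area ?T A \<le> mixed_area ?I A" using \<delta> by (simp add: mixed_area_commute)
  moreover have "- edge_normal (r - p) = edge_normal (p - r)" by (simp add: edge_normal_def vec_eq_2)
  ultimately have le: "supp A (edge_normal (q - p)) + supp A (edge_normal (r - q)) \<le> supp A (edge_normal (r - p))"
    using A pos by (simp add: mixed_area_triangle mixed_area_segment orient_def width_def)
  obtain w where w: "w \<in> A" "w \<bullet> edge_normal (r - p) = supp A (edge_normal (r - p))"
    using supp_attained A unfolding convex_body_def by metis
  \<comment> \<open>The two edge normals add up to the third, so \<open>le\<close> forces the
    maximiser of the third to be extremal for both.\<close>
  have "w \<bullet> edge_normal (r - p) = w \<bullet> edge_normal (q - p) + w \<bullet> edge_normal (r - q)"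
    by (simp add: inner_edge_normal cross2_def algebra_simps)
  moreover have "w \<bullet> edge_normal (q - p) \<le> supp A (edge_normal (q - p))"
    "w \<bullet> edge_normal (r - q) \<le> supp A (edge_normal (r - q))"
    using w A by (auto simp: convex_body_def intro: supp_ge)
  ultimately show ?thesis using that[OF w(1)] w(2) le by linarith
qed

text \<open>Two corners \<open>y\<close>, \<open>z\<close> of the circumscribed triangle lie in
  \<open>A\<close>. Together with \<open>p\<close> they span a larger triangle than
  \<open>p q r\<close> unless the supporting lines of \<open>A\<close> contain the edges of
  \<open>p q r\<close>.\<close>

lemma equals_hull_if_corners_missing:
  assumes eq: "mixed_area A (uminus ` A) = 2 * area A" and out: "p + r - q \<notin> A" "p + q - r \<notin> A"
  shows "A = convex hull {p, q, r}"
proof -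
  let ?d = "orient p q r"
  interpret rot: largest_triangle A q r p by (rule rotate)
  obtain y where y: "y \<in> A" "y \<bullet> edge_normal (q - p) = supp A (edge_normal (q - p))"
    "y \<bullet> edge_normal (r - q) = supp A (edge_normal (r - q))"
    using circumscribed_corner[OF eq out(1)] .
  obtain z where z: "z \<in> A" "z \<bullet> edge_normal (r - q) = supp A (edge_normal (r - q))"
    "z \<bullet> edge_normal (p - r) = supp A (edge_normal (p - r))"
    using rot.circumscribed_corner[OF eq] out(2) by (metis add.commute)
  \<comment> \<open>How far the supporting lines of \<open>A\<close> parallel to the edges overshoot
    those edges, in units of twice the area.\<close>
  define \<alpha> where "\<alpha> = supp A (edge_normal (r - q)) - cross2 q (r - q)"
  define \<beta> where "\<beta> = supp A (edge_normal (p - r)) - cross2 r (p - r)"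
  define \<gamma> where "\<gamma> = supp A (edge_normal (q - p)) - cross2 p (q - p)"
  have nonneg: "0 \<le> \<alpha>" "0 \<le> \<beta>" "0 \<le> \<gamma>"
    using supp_ge[of A] A vertices
    by (auto simp: \<alpha>_def \<beta>_def \<gamma>_def convex_body_def simp flip: inner_edge_normal)
  have "orient y q r = - \<alpha>" "orient z q r = - \<alpha>"
    using y z by (simp_all add: orient_edge \<alpha>_def inner_edge_normal)
  moreover have yz: "orient p q y = - \<gamma>" "orient p z r = - \<beta>"
    using y z orient_edge[of y p q] orient_edge[of z r p]
    by (simp_all add: orient_cycle[of y p q] orient_cycle[of p z r]
        \<gamma>_def \<beta>_def inner_edge_normal)
  ultimately have yz': "orient p y r = ?d + \<alpha> + \<gamma>" "orient p q z = ?d + \<alpha> + \<beta>"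
    using orient_sum[of y q r p] orient_sum[of z q r p] by simp_all
  \<comment> \<open>\<open>p\<close> has barycentric coordinates \<open>(1, 0, 0)\<close>, so this
    is a 2 by 2 minor of the coordinates of \<open>y\<close> and \<open>z\<close>.\<close>
  have "?d * orient p y z = orient p y r * orient p q z - orient p q y * orient p z r"
    by (simp add: orient_def cross2_def algebra_simps)
  also have "\<dots> = ?d * ?d + ?d * (2 * \<alpha> + \<beta> + \<gamma>) + \<alpha> * (\<alpha> + \<beta> + \<gamma>)"
    unfolding yz yz' by (simp add: algebra_simps)
  finally have "?d * (2 * \<alpha> + \<beta> + \<gamma>) + \<alpha> * (\<alpha> + \<beta> + \<gamma>) = ?d * (orient p y z - ?d)"
    by (simp add: algebra_simps)
  also have "\<dots> \<le> 0"
    using largest[OF vertices(1) y(1) z(1)] pos by (simp add: mult_le_0_iff)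
  finally have "?d * (2 * \<alpha> + \<beta> + \<gamma>) \<le> 0"
    using nonneg by (smt (verit) mult_nonneg_nonneg)
  then have zero: "\<alpha> = 0" "\<beta> = 0" "\<gamma> = 0"
    using nonneg pos by (auto simp: mult_le_0_iff)
  have "x \<in> convex hull {p, q, r}" if "x \<in> A" for x
  proof -
    have le: "cross2 x e \<le> supp A (edge_normal e)" for e
      using supp_ge[of A x "edge_normal e"] that A by (simp add: convex_body_def inner_edge_normal)
    have "0 \<le> orient x q r" "0 \<le> orient p x r" "0 \<le> orient p q x"
      using le[of "r - q"] le[of "p - r"] le[of "q - p"] zero
        orient_edge[of x q r] orient_edge[of x r p] orient_edge[of x p q]
      by (simp_all add: \<alpha>_def \<beta>_def \<gamma>_def orient_cycle[of x p q] orient_cycle[of p x r])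
    moreover have "orient x q r / ?d + orient p x r / ?d + orient p q x / ?d = 1"
      using pos by (simp add: orient_sum add_divide_distrib[symmetric])
    ultimately have "(orient x q r / ?d) *\<^sub>R p + (orient p x r / ?d) *\<^sub>R q + (orient p q x / ?d) *\<^sub>R r
      \<in> (*\<^sub>R) 1 ` (convex hull {p, q, r})"
      using pos by (intro hull_3_scaleI) auto
    then show ?thesis using barycentric'[of p q r x] pos by simp
  qed
  then show ?thesis using hull_subset by blast
qed

text \<open>Two such points and \<open>p\<close> would span a triangle of twice the largest area.
  With rotation, at least two of the three anticomplementary vertices are missing from
  \<open>A\<close>.\<close>

lemma corner_exclusion:
  assumes "q + r - p \<in> A"
  shows "p + r - q \<notin> A"
proof
  assume "p + r - q \<in> A"
  then have "orient p (q + r - p) (p + r - q) \<le> orient p q r"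
    using assms vertices by (intro largest)
  moreover have "orient p (q + r - p) (p + r - q) = 2 * orient p q r"
    by (simp add: orient_def cross2_def algebra_simps)
  ultimately show False using pos by simp
qed

end

text \<open>Rotate the labels so that the missing vertices are the two required by
  \<open>equals_hull_if_corners_missing\<close>.\<close>

lemma rogers_shephard_equality:
  assumes "largest_triangle A p q r" and eq: "mixed_area A (uminus ` A) = 2 * area A"
  shows "A = convex hull {p, q, r}"
proof -
  interpret pqr: largest_triangle A p q r by fact
  interpret qrp: largest_triangle A q r p by (rule pqr.rotate)
  interpret rpq: largest_triangle A r p q by (rule qrp.rotate)
  have perm: "{q, r, p} = {p, q, r}" "{r, p, q} = {p, q, r}" by auto
  have comm: "r + p - q = p + r - q" "q + p - r = p + q - r" "r + q - p = q + r - p" by simp_all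
  consider "p + r - q \<notin> A" "p + q - r \<notin> A" | "p + r - q \<in> A" | "p + q - r \<in> A" by blast
  then show ?thesis
  proof cases
    case 1
    then show ?thesis by (rule pqr.equals_hull_if_corners_missing[OF eq])
  next
    case 2
    then have "p + q - r \<notin> A" "q + r - p \<notin> A"
      using qrp.corner_exclusion pqr.corner_exclusion by (auto simp: comm)
    then show ?thesis
      using qrp.equals_hull_if_corners_missing[OF eq] by (simp add: comm perm)
  next
    case 3
    then have "p + r - q \<notin> A" "q + r - p \<notin> A"
      using qrp.corner_exclusion rpq.corner_exclusion by (auto simp: comm)
    then show ?thesis
      using rpq.equals_hull_if_corners_missing[OF eq] by (simp add: comm perm)
  qed
qed

text \<open>Compactness gives a maximiser; a maximum of zero would make \<open>A\<close> collinear
  and hence of area zero.\<close>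

lemma largest_triangle_exists:
  assumes A: "convex_body A" and "area A \<noteq> 0"
  obtains p q r where "largest_triangle A p q r"
proof -
  let ?f = "\<lambda>(x, y, z). orient x y z"
  have "continuous_on (A \<times> A \<times> A) ?f"
    unfolding case_prod_unfold orient_def cross2_def by (intro continuous_intros)
  moreover have "compact (A \<times> A \<times> A)" "A \<times> A \<times> A \<noteq> {}"
    using A by (auto simp: convex_body_def compact_Times)
  ultimately obtain t where "t \<in> A \<times> A \<times> A" "\<And>t'. t' \<in> A \<times> A \<times> A \<Longrightarrow> ?f t' \<le> ?f t"
    using continuous_attains_sup by meson
  then obtain p q r where pqr: "p \<in> A" "q \<in> A" "r \<in> A"
    and max: "\<And>x y z. x \<in> A \<Longrightarrow> y \<in> A \<Longrightarrow> z \<in> A \<Longrightarrow> orient x y z \<le> orient p q r"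
    by (cases t) fastforce
  have "0 < orient p q r"
  proof (rule ccontr)
    assume "\<not> ?thesis"
    then have "orient x y z = 0" if "x \<in> A" "y \<in> A" "z \<in> A" for x y z
      using max[of x y z] max[of x z y] that orient_swap[of x y z] by linarith
    then have "collinear A" by (rule collinear_if_orient_0)
    then obtain a b where "A = closed_segment a b"
      using A compact_convex_collinear_segment_alt[of A] by (auto simp: convex_body_def convex_connected)
    with assms(2) show False by (simp add: area_segment)
  qed
  with A pqr max have "largest_triangle A p q r" by unfold_locales auto
  then show ?thesis by (rule that)
qed

section \<open>Asymmetry of the mixed area\<close>

lemma minkowski_diff_eq: "minkowski_diff A C = minkowski_sum A (uminus ` C)"
  by (force simp: minkowski_diff_def minkowski_sum_def)

section \<open>Equality for two triangles\<close>

text \<open>The coordinates of the three edge functionals on the vertices of a second triangle; after subtracting the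
  medians \<open>m\<^sub>1, m\<^sub>2, m\<^sub>3\<close> of the rows, the \<open>3 \<times> 3\<close> matrix is diagonally dominant with column sums \<open>s\<close>, and the
  matrix-tree expansion of its determinant has only nonnegative terms.\<close>

lemma dominant_determinant:
  fixes x1 x2 x3 y1 y2 y3 m1 m2 m3 :: real
  defines "z1 \<equiv> - x1 - y1" and "z2 \<equiv> - x2 - y2" and "z3 \<equiv> - x3 - y3" and "s \<equiv> m1 + m2 + m3"
  assumes "0 < s" "m1 \<le> x2" "m1 \<le> x3" "m2 \<le> y1" "m2 \<le> y3" "m3 \<le> z1" "m3 \<le> z2"
    and det: "\<bar>(x2 - x1) * (y3 - y1) - (x3 - x1) * (y2 - y1)\<bar> = s\<^sup>2"
  shows "x2 = m1" "x3 = m1" "y1 = m2" "y3 = m2" "z1 = m3" "z2 = m3"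
proof -
  \<comment> \<open>The six off-diagonal excesses over the medians. Diagonal entries are eliminated
    because each column sums to zero.\<close>
  define a b c d e f where "a = x2 - m1" "b = x3 - m1" "c = y1 - m2" "d = y3 - m2" "e = z1 - m3" "f = z2 - m3"
  note defs = this
  have nonneg: "0 \<le> a" "0 \<le> b" "0 \<le> c" "0 \<le> d" "0 \<le> e" "0 \<le> f"
    using assms by (auto simp: defs)
  have x: "x2 - x1 = s + a + c + e" "y3 - y1 = d - c" "x3 - x1 = s + b + c + e" "y2 - y1 = - (s + a + f + c)"
    by (simp_all add: defs s_def z1_def z2_def)
  have "(x2 - x1) * (y3 - y1) - (x3 - x1) * (y2 - y1)
     = s\<^sup>2 + s * (a + b + c + d + e + f) + (a * d + c * d + e * d + b * a + b * f + b * c + c * f + e * a + e * f)"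
    unfolding x by (simp add: power2_eq_square algebra_simps)
  moreover have "0 \<le> a * d + c * d + e * d + b * a + b * f + b * c + c * f + e * a + e * f"
    using nonneg by simp
  moreover have "0 \<le> s * (a + b + c + d + e + f)" using nonneg \<open>0 < s\<close> by simp
  ultimately have "s * (a + b + c + d + e + f) \<le> 0" using det by (smt (verit) zero_le_power2)
  then have "a + b + c + d + e + f \<le> 0" using \<open>0 < s\<close> by (simp add: mult_le_0_iff)
  with nonneg show "x2 = m1" "x3 = m1" "y1 = m2" "y3 = m2" "z1 = m3" "z2 = m3"
    by (simp_all add: defs)
qed

lemma parallel_scale:
  assumes "cross2 u e = 0" "cross2 u f = s" "0 < cross2 e f"
  shows "u = (s / cross2 e f) *\<^sub>R e"
proof -
  have "e \<noteq> 0" using assms(3) by (auto simp: cross2_def)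
  moreover have "cross2 e u = 0" using assms(1) by (simp add: cross2_def algebra_simps)
  ultimately obtain k where k: "u = k *\<^sub>R e" using cross2_eq_0_imp_multiple by blast
  with assms(2) have "s = k * cross2 e f" by (simp add: cross2_def algebra_simps)
  with k assms(3) show ?thesis by simp
qed

text \<open>\<open>dominant_determinant\<close> makes the off-diagonal entries equal row by row, so
  each edge of the second triangle is parallel to one of the first, with common ratio
  \<open>t\<close>. The absolute value admits relabelled vertices of either orientation.\<close>

lemma aligned_triangles_homothetic:
  fixes p q r c1 c2 c3 :: "real^2"
  defines "x \<equiv> \<lambda>c. cross2 c (q - p)" and "y \<equiv> \<lambda>c. cross2 c (r - q)" and "z \<equiv> \<lambda>c. cross2 c (p - r)"
  assumes pos: "0 < orient p q r" and s: "0 < m1 + m2 + m3"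
    and rows: "m1 \<le> x c2" "m1 \<le> x c3" "m2 \<le> y c1" "m2 \<le> y c3" "m3 \<le> z c1" "m3 \<le> z c2"
    and det: "orient p q r * \<bar>orient c1 c2 c3\<bar> = (m1 + m2 + m3)\<^sup>2"
  shows "\<exists>t b. t > 0 \<and> convex hull {c1, c2, c3} = (\<lambda>x. t *\<^sub>R x + b) ` (convex hull {p, q, r})"
proof -
  let ?s = "m1 + m2 + m3" and ?d = "orient p q r"
  have z: "z c = - x c - y c" for c by (simp add: x_def y_def z_def cross2_def algebra_simps)
  have "(x c2 - x c1) * (y c3 - y c1) - (x c3 - x c1) * (y c2 - y c1) = ?d * orient c1 c2 c3"
    by (simp add: x_def y_def orient_def cross2_def algebra_simps)
  then have "\<bar>(x c2 - x c1) * (y c3 - y c1) - (x c3 - x c1) * (y c2 - y c1)\<bar> = ?s\<^sup>2"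
    using det pos by (simp add: abs_mult)
  then have eqs: "x c2 = m1" "x c3 = m1" "y c1 = m2" "y c3 = m2" "z c1 = m3" "z c2 = m3"
    using dominant_determinant[of m1 m2 m3 "x c2" "x c3" "y c1" "y c3" "x c1" "y c2"] s rows
    unfolding z by auto
  have orients: "cross2 (p - r) (q - p) = ?d" "cross2 (q - p) (r - q) = ?d"
    by (simp_all add: orient_def cross2_def algebra_simps)
  define t where "t = ?s / ?d"
  have c21: "c2 - c1 = t *\<^sub>R (p - r)"
  proof -
    have "cross2 (c2 - c1) (p - r) = 0" "cross2 (c2 - c1) (q - p) = ?s"
      using eqs z[of c1] z[of c2] by (simp_all add: x_def y_def z_def cross2_def algebra_simps)
    then show ?thesis using parallel_scale pos orients unfolding t_def by metis
  qed
  have c32: "c3 - c2 = t *\<^sub>R (q - p)"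
  proof -
    have "cross2 (c3 - c2) (q - p) = 0" "cross2 (c3 - c2) (r - q) = ?s"
      using eqs z[of c1] z[of c2] by (simp_all add: x_def y_def z_def cross2_def algebra_simps)
    then show ?thesis using parallel_scale pos orients unfolding t_def by metis
  qed
  have "c3 - c1 = (c3 - c2) + (c2 - c1)" by simp
  also have "\<dots> = t *\<^sub>R (q - r)" unfolding c21 c32 by (simp add: algebra_simps)
  finally have c: "c2 = t *\<^sub>R p + (c1 - t *\<^sub>R r)" "c3 = t *\<^sub>R q + (c1 - t *\<^sub>R r)"
    "c1 = t *\<^sub>R r + (c1 - t *\<^sub>R r)"
    using c21 by (simp_all add: algebra_simps)
  have "(\<lambda>x. t *\<^sub>R x + (c1 - t *\<^sub>R r)) ` (convex hull {p, q, r})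
      = convex hull ((\<lambda>x. t *\<^sub>R x + (c1 - t *\<^sub>R r)) ` {p, q, r})"
    using convex_hull_affinity[of "c1 - t *\<^sub>R r" t "{p, q, r}"] by (simp only: add.commute)
  also have "\<dots> = convex hull {c1, c2, c3}"
    using c by (simp add: insert_commute)
  finally have "convex hull {c1, c2, c3} = (\<lambda>x. t *\<^sub>R x + (c1 - t *\<^sub>R r)) ` (convex hull {p, q, r})" ..
  moreover have "0 < t" using s pos by (simp add: t_def)
  ultimately show ?thesis by blast
qed

text \<open>Equality turns into a determinant identity for the matrix of edge functionals at the
  vertices of \<open>C\<close>; what remains is to label those vertices so that the matrix has the
  form required by \<open>aligned_triangles_homothetic\<close>.\<close>

lemma triangles_homothetic:
  fixes p q r c1 c2 c3 :: "real^2"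
  defines "A \<equiv> convex hull {p, q, r}" and "C \<equiv> convex hull {c1, c2, c3}"
  assumes A: "0 < orient p q r" and C: "0 < orient c1 c2 c3"
    and eq: "mixed_area A (uminus ` C) = mixed_area A C + sqrt (area A * area C)"
  shows "\<exists>t b. t > 0 \<and> C = (\<lambda>x. t *\<^sub>R x + b) ` A"
proof -
  define median where "median a b c = a + b + c - min a (min b c) - max a (max b c)" for a b c :: real
  define x y z where "x = (\<lambda>c. cross2 c (q - p))" "y = (\<lambda>c. cross2 c (r - q))" "z = (\<lambda>c. cross2 c (p - r))"
  note xyz = this
  define m1 m2 m3 where "m1 = median (x c1) (x c2) (x c3)" "m2 = median (y c1) (y c2) (y c3)"
    "m3 = median (z c1) (z c2) (z c3)"
  note m = this
  let ?s = "m1 + m2 + m3"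
  have sum0: "x c + y c + z c = 0" for c by (simp add: xyz cross2_def algebra_simps)
  have bodies: "convex_body A" "convex_body C" by (simp_all add: A_def C_def convex_body_hull)
  \<comment> \<open>Support values of \<open>C\<close> and its reflection are the maximum and minus
    the minimum of three numbers. The sums of the three numbers cancel over the edges, leaving the
    medians.\<close>
  have diff: "supp (uminus ` C) (edge_normal e) - supp C (edge_normal e)
      = median (cross2 c1 e) (cross2 c2 e) (cross2 c3 e) - (cross2 c1 e + cross2 c2 e + cross2 c3 e)" for e
    using bodies by (simp add: supp_uminus C_def convex_body_hull supp_hull_3 inner_edge_normal median_def
        max_def min_def)
  have "2 * (mixed_area A (uminus ` C) - mixed_area A C) = ?s"
    using A bodies diff[of "q - p"] diff[of "r - q"] diff[of "p - r"] sum0[of c1] sum0[of c2] sum0[of c3]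
    unfolding A_def
    by (simp add: mixed_area_triangle orient_def convex_body_uminus m xyz add_divide_distrib)
  then have s_eq: "?s = 2 * sqrt (area A * area C)" using eq by simp
  have areas: "area A = orient p q r / 2" "area C = orient c1 c2 c3 / 2"
    using A C by (simp_all add: A_def C_def area_triangle)
  have s: "0 < ?s" using s_eq A C by (simp add: areas)
  have det: "?s\<^sup>2 = orient p q r * orient c1 c2 c3"
    using A C unfolding s_eq by (simp add: areas power_mult_distrib)
  have below: "a < median a b c \<Longrightarrow> median a b c \<le> b \<and> median a b c \<le> c"
    "b < median a b c \<Longrightarrow> median a b c \<le> a \<and> median a b c \<le> c"
    "c < median a b c \<Longrightarrow> median a b c \<le> a \<and> median a b c \<le> b" for a b c :: real
    by (auto simp: median_def max_def min_def split: if_splits)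
  \<comment> \<open>A column sums to zero while the medians sum to a positive number, so every
    vertex is below the median in some row.\<close>
  have col: "x c < m1 \<or> y c < m2 \<or> z c < m3" for c using sum0[of c] s by linarith
  note row1 = below[where a="x c1" and b="x c2" and c="x c3", folded m]
    and row2 = below[where a="y c1" and b="y c2" and c="y c3", folded m]
    and row3 = below[where a="z c1" and b="z c2" and c="z c3", folded m]
  have result: ?thesis
    if "{a, b, c} = {c1, c2, c3}" "\<bar>orient a b c\<bar> = orient c1 c2 c3"
      "m1 \<le> x b" "m1 \<le> x c" "m2 \<le> y a" "m2 \<le> y c" "m3 \<le> z a" "m3 \<le> z b" for a b c
    using aligned_triangles_homothetic[OF A s, of b c a] that det unfolding A_def C_def xyz by simp
  have perms: "\<bar>orient c1 c3 c2\<bar> = orient c1 c2 c3" "\<bar>orient c2 c1 c3\<bar> = orient c1 c2 c3"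
    "\<bar>orient c2 c3 c1\<bar> = orient c1 c2 c3" "\<bar>orient c3 c1 c2\<bar> = orient c1 c2 c3"
    "\<bar>orient c3 c2 c1\<bar> = orient c1 c2 c3" "\<bar>orient c1 c2 c3\<bar> = orient c1 c2 c3"
    using C by (auto simp: orient_def cross2_def algebra_simps)
  have sets: "{c1, c3, c2} = {c1, c2, c3}" "{c2, c1, c3} = {c1, c2, c3}" "{c2, c3, c1} = {c1, c2, c3}"
    "{c3, c1, c2} = {c1, c2, c3}" "{c3, c2, c1} = {c1, c2, c3}" by auto
  \<comment> \<open>At most one vertex is strictly below the median in each row, so the three
    vertices use the three rows in one of six orders.\<close>
  consider "x c1 < m1" "y c2 < m2" "z c3 < m3" | "x c1 < m1" "z c2 < m3" "y c3 < m2"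
    | "y c1 < m2" "x c2 < m1" "z c3 < m3" | "y c1 < m2" "z c2 < m3" "x c3 < m1"
    | "z c1 < m3" "x c2 < m1" "y c3 < m2" | "z c1 < m3" "y c2 < m2" "x c3 < m1"
    using col[of c1] col[of c2] col[of c3] row1 row2 row3 by (metis not_less)
  then show ?thesis
  proof cases
    case 1 then show ?thesis using row1 row2 row3 perms by (intro result[of c1 c2 c3]) auto
  next
    case 2 then show ?thesis using row1 row2 row3 perms sets by (intro result[of c1 c3 c2]) auto
  next
    case 3 then show ?thesis using row1 row2 row3 perms sets by (intro result[of c2 c1 c3]) auto
  next
    case 4 then show ?thesis using row1 row2 row3 perms sets by (intro result[of c3 c1 c2]) auto
  next
    case 5 then show ?thesis using row1 row2 row3 perms sets by (intro result[of c2 c3 c1]) auto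
  next
    case 6 then show ?thesis using row1 row2 row3 perms sets by (intro result[of c3 c2 c1]) auto
  qed
qed

section \<open>The inequality from Minkowski and Rogers-Shephard\<close>

text \<open>Minkowski's inequality for \<open>s A - t C\<close> against its reflection, expanded by bilinearity.\<close>

lemma mixed_area_asymmetry:
  assumes A: "convex_body A" and C: "convex_body C" and "0 \<le> s" "0 \<le> t"
  shows "2 * s * t * (mixed_area A (uminus ` C) - mixed_area A C)
    \<le> s\<^sup>2 * (mixed_area A (uminus ` A) - area A) + t\<^sup>2 * (mixed_area C (uminus ` C) - area C)"
proof -
  let ?sA = "(*\<^sub>R) s ` A" and ?tC = "(*\<^sub>R) t ` uminus ` C"
  let ?nA = "uminus ` A" and ?nC = "uminus ` C"
  have nn: "uminus ` uminus ` Z = Z" for Z :: "(real^2) set" by (simp add: image_image)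
  note cb = A C convex_body_uminus[OF A] convex_body_uminus[OF C]
  have neg: "uminus ` minkowski_sum ?sA ?tC = minkowski_sum ((*\<^sub>R) s ` ?nA) ((*\<^sub>R) t ` C)"
    by (subst minkowski_sum_linear_image[symmetric]) (auto intro: linearI simp: image_image)
  have sums: "convex_body (minkowski_sum ?sA ?tC)"
    using cb by (simp add: convex_body_sum convex_body_scale)
  have "mixed_area (minkowski_sum ?sA ?tC) (minkowski_sum ?sA ?tC)
      \<le> mixed_area (minkowski_sum ?sA ?tC) (minkowski_sum ((*\<^sub>R) s ` ?nA) ((*\<^sub>R) t ` C))"
    using area_le_mixed_area_uminus[OF sums] by (simp add: neg mixed_area_self[OF sums])
  then have "s * (s * mixed_area A A) + s * (t * mixed_area A ?nC) + (t * (s * mixed_area ?nC A) + t * (t * mixed_area ?nC ?nC))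
      \<le> s * (s * mixed_area A ?nA) + s * (t * mixed_area A C) + (t * (s * mixed_area ?nC ?nA) + t * (t * mixed_area ?nC C))"
    using cb \<open>0 \<le> s\<close> \<open>0 \<le> t\<close>
    by (simp add: mixed_area_add_left mixed_area_add_right mixed_area_scale_left mixed_area_scale_right
        convex_body_sum convex_body_scale algebra_simps)
  moreover have "mixed_area A A = area A" "mixed_area ?nC ?nC = area C"
    "mixed_area ?nC A = mixed_area A ?nC" "mixed_area ?nC ?nA = mixed_area A C"
    "mixed_area ?nC C = mixed_area C ?nC"
    using A C mixed_area_commute by (auto simp: mixed_area_self mixed_area_uminus)
  ultimately show ?thesis by (simp add: power2_eq_square algebra_simps)
qed

text \<open>Only a width enters, and widths ignore reflection; this settles the case where a body
  has area zero.\<close>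

lemma mixed_area_segment_uminus:
  assumes C: "convex_body C"
  shows "mixed_area (closed_segment p q) (uminus ` C) = mixed_area (closed_segment p q) C"
  using C by (simp add: mixed_area_segment convex_body_uminus width_def supp_uminus)

theorem theorem5p4:
  fixes A C :: "(real^2) set"
  assumes "compact A" "convex A" "A \<noteq> {}"
      and "compact C" "convex C" "C \<noteq> {}"
  shows "measure lebesgue (minkowski_diff A C)
           \<le> measure lebesgue (minkowski_sum A C)
              + 2 * sqrt (measure lebesgue A * measure lebesgue C)
     \<and> (measure lebesgue (minkowski_diff A C)
           = measure lebesgue (minkowski_sum A C)
              + 2 * sqrt (measure lebesgue A * measure lebesgue C)
         \<longrightarrow> point_or_segment A \<or> point_or_segment C
             \<or> (is_triangle A \<and> (\<exists>t b. t > 0 \<and> C = (\<lambda>x. t *\<^sub>R x + b) ` A)))"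
proof -
  have A: "convex_body A" and C: "convex_body C" using assms by (auto simp: convex_body_def)
  let ?a = "area A" and ?c = "area C"
  define F where "F = mixed_area A (uminus ` C) - mixed_area A C"
  have gap: "area (minkowski_diff A C) = area (minkowski_sum A C) + 2 * F"
    using A C by (simp add: minkowski_diff_eq area_sum convex_body_uminus area_uminus F_def)
  have "F \<le> sqrt (?a * ?c) \<and> (F = sqrt (?a * ?c) \<longrightarrow> point_or_segment A \<or> point_or_segment C
             \<or> (is_triangle A \<and> (\<exists>t b. t > 0 \<and> C = (\<lambda>x. t *\<^sub>R x + b) ` A)))"
  proof (cases "?a = 0 \<or> ?c = 0")
    case True
    then show ?thesis
    proof
      assume "?a = 0"
      then obtain p q where pq: "A = closed_segment p q" using area_0_imp_segment[OF A] by blast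
      then have "F = 0" using C by (simp add: F_def mixed_area_segment_uminus)
      moreover have "point_or_segment A" using pq by (auto simp: point_or_segment_def)
      ultimately show ?thesis using \<open>?a = 0\<close> by simp
    next
      assume "?c = 0"
      then obtain p q where pq: "C = closed_segment p q" using area_0_imp_segment[OF C] by blast
      \<comment> \<open>Reflecting both arguments moves the sign from the segment \<open>C\<close>
        to \<open>A\<close>.\<close>
      have "mixed_area A (uminus ` C) = mixed_area (uminus ` A) (uminus ` uminus ` C)"
        using A C by (simp only: mixed_area_uminus convex_body_uminus)
      also have "\<dots> = mixed_area (uminus ` A) C" by (simp add: image_image)
      also have "\<dots> = mixed_area C (uminus ` A)" by (rule mixed_area_commute)
      also have "\<dots> = mixed_area C A" unfolding pq using A by (rule mixed_area_segment_uminus)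
      also have "\<dots> = mixed_area A C" by (rule mixed_area_commute)
      finally have "F = 0" by (simp add: F_def)
      moreover have "point_or_segment C" using pq by (auto simp: point_or_segment_def)
      ultimately show ?thesis using \<open>?c = 0\<close> by simp
    qed
  next
    case False
    then have pos: "0 < ?a" "0 < ?c" by (simp_all add: zero_less_measure_iff order_less_le)
    obtain p q r where pqr: "largest_triangle A p q r"
      using largest_triangle_exists A False by blast
    obtain c1 c2 c3 where c: "largest_triangle C c1 c2 c3"
      using largest_triangle_exists C False by blast
    \<comment> \<open>The Rogers-Shephard deficit; both deficits are kept in \<open>main\<close> so
      that equality can be read off.\<close>
    let ?rs = "\<lambda>Z. 2 * area Z - mixed_area Z (uminus ` Z)"
    have rs: "0 \<le> ?rs A" "0 \<le> ?rs C"
      using largest_triangle.rogers_shephard[OF pqr] largest_triangle.rogers_shephard[OF c] by simp_all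
    have "2 * sqrt ?c * sqrt ?a * F \<le> ?c * (?a - ?rs A) + ?a * (?c - ?rs C)"
      using mixed_area_asymmetry[OF A C, of "sqrt ?c" "sqrt ?a"] pos by (simp add: F_def)
    then have main: "2 * sqrt (?a * ?c) * F \<le> 2 * (?a * ?c) - ?c * ?rs A - ?a * ?rs C"
      by (simp add: real_sqrt_mult algebra_simps)
    have sq: "?a * ?c = sqrt (?a * ?c) * sqrt (?a * ?c)" "0 < sqrt (?a * ?c)" using pos by simp_all
    have "0 \<le> ?c * ?rs A" "0 \<le> ?a * ?rs C" using rs pos by (simp_all add: mult_nonneg_nonneg)
    note nonneg = this
    have "sqrt (?a * ?c) * F \<le> sqrt (?a * ?c) * sqrt (?a * ?c)"
      using main nonneg sq(1) by linarith
    then have le: "F \<le> sqrt (?a * ?c)" using sq(2) by (simp only: mult_le_cancel_left_pos)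
    moreover have "is_triangle A \<and> (\<exists>t b. t > 0 \<and> C = (\<lambda>x. t *\<^sub>R x + b) ` A)"
      if eq: "F = sqrt (?a * ?c)"
    proof -
      have "2 * sqrt (?a * ?c) * F = 2 * (?a * ?c)" unfolding eq using sq(1) by linarith
      \<comment> \<open>Equality leaves no room for either nonnegative deficit.\<close>
      then have "?c * ?rs A = 0" "?a * ?rs C = 0" using main nonneg by linarith+
      then have "mixed_area A (uminus ` A) = 2 * ?a" "mixed_area C (uminus ` C) = 2 * ?c"
        using pos by simp_all
      then have hulls: "A = convex hull {p, q, r}" "C = convex hull {c1, c2, c3}"
        using rogers_shephard_equality pqr c by blast+
      have orients: "0 < orient p q r" "0 < orient c1 c2 c3"
        using largest_triangle.pos pqr c by blast+
      have "\<not> collinear {p, q, r}"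
      proof
        assume "collinear {p, q, r}"
        then obtain u k l where "q - p = k *\<^sub>R u" "r - p = l *\<^sub>R u"
          unfolding collinear_def by blast
        then have "orient p q r = 0" unfolding orient_def by (simp add: cross2_def)
        with orients(1) show False by simp
      qed
      then have "is_triangle A" unfolding is_triangle_def using hulls(1) by blast
      moreover have "\<exists>t b. t > 0 \<and> C = (\<lambda>x. t *\<^sub>R x + b) ` A"
        using triangles_homothetic[OF orients, folded hulls] eq by (simp add: F_def)
      ultimately show ?thesis by blast
    qed
    ultimately show ?thesis by blast
  qed
  then show ?thesis unfolding gap by simp
qed

end
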